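(* (Liftings of type $B_\theta$, $\theta\ge2$, for Drinfeld-Jimbo type braidings.) Let $\mu=(\mu_\alpha)_{\alpha\in\Phi^+}=(\mu_{ij})$, $1\le i\le\theta$, $i+1\le j\le i'-1$ (where $j'=2\theta+2-j$), be a family of root vector parameters. For $1\le i<j\le\theta+1$ let $$r_{j'i'}:=(q_1^2-1)^N\mu_{ij},\qquad r_{ji'}:=(-1)^{\theta+1-j}\tfrac12(q_1^2-1)^N(q_1-1)^N\mu_{ij'}\ \text{ if }j\neq\theta+1,$$ and extend this definition to all indices $r_{ij}$ so that the upper unitriangular matrix $Q_r=(r_{ij})$ belongs to $\mathrm{SO}_{2\theta+1}$. Then the power root vector relations $x_\alpha^N=r_\alpha(\mu)$, $\alpha\in\Phi^+$, of the pointed Hopf algebra $u(\mathcal D_Q,\mu)$ are given as follows: for all $1\le i<j\le\theta+1$, $$x_{(ij)}^N=\mu_{ij}\big(g_{(ij)}^N-1\big)-\sum_{s=i+1}^{j-1}r_{j's'}\,x_{(is)}^N,$$ and, if $j\ne\theta+1$, $$\begin{aligned}x_{(ij')}^N={}&\mu_{ij'}\big(g_{(ij')}^N-1\big)-2(-1)^{\theta+1-j}(1+q_1)^{-N}\sum_{s=i+1}^{\theta}r_{js'}\,x_{(is)}^N\\&-2(-1)^{\theta+1-j}(1+q_1)^{-N}r_{j\,\theta+1}\,x_{(i\,\theta+1)}^N-\sum_{s=\theta+2}^{j'-1}(-1)^{s-j}r_{js'}\,x_{(is)}^N.\end{aligned}$$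
   Context: Everything is over $\mathbb C$. $\theta\ge2$, $I=\{1,\dots,\theta\}$, $\mathtt n=2\theta+1$, $k'=2\theta+2-k$. $q$ is a primitive root of unity of odd order $N>7$ with $\gcd(3,N)=1$. Type $B_\theta$: simple roots $\alpha_i$, Cartan matrix $(a_{ij})$, $d_i=2$ for $i<\theta$, $d_\theta=1$, root lattice $Q$; $q_1=q^{d_1}=q^2$, $q_1^{1/2}=q$ (so $q_1^{N/2}=1$). Positive roots $\Phi^+=\{\alpha_{ij}: 1\le i\le\theta,\ i<j\le i'-1\}$: $\alpha_{ij}=\alpha_i+\cdots+\alpha_{j-1}$ for $i<j\le\theta+1$, and $\alpha_{ij'}=\alpha_i+\cdots+\alpha_{j-1}+2\alpha_j+\cdots+2\alpha_\theta$ for $\theta+1<j'\le i'-1$; $\mu_{ij}:=\mu_{\alpha_{ij}}$. The algebra $u(\mathcal D_Q,\mu)$. $\Gamma=\mathbb Z^\theta/(n_1\mathbb Z\times\cdots\times n_\theta\mathbb Z)$ with $N\mid n_i$, with canonical generators $g_i=g_{\alpha_i}$ of order $n_i$; $g_\alpha=\prod g_i^{k_i}$ and $\chi_\alpha=\prod\chi_i^{k_i}$ for $\alpha=\sum k_i\alpha_i$, where $\chi_j\in\widehat\Gamma$, $\chi_j(g_i)=q^{d_ia_{ij}}$. Root vector parameters: $\mu_\alpha\in\mathbb C$ with $\mu_\alpha=0$ if $g_\alpha^N=1$ or $\chi_\alpha^N\ne\varepsilon$. $u(\mathcal D_Q,\mu)$ is the pointed Hopf algebra generated by $\Gamma$ and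 $x_1,\dots,x_\theta$ with relations $gx_ig^{-1}=\chi_i(g)x_i$, $(\mathrm{ad}_c x_i)^{1-a_{ij}}(x_j)=0$ for $i\ne j$ ($\mathrm{ad}_c$ the braided adjoint action), and $x_\alpha^N=r_\alpha(\mu)$ for positive roots $\alpha$, where $x_\alpha$ are root vectors and $r_\alpha(\mu)\in\mathbb C[g_i^N\mid i\in I]$ are defined recursively by $r_\alpha(\mu)=\mu_\alpha(1-g_\alpha^N)+\sum_{\beta,\gamma\ne0,\ \beta+\gamma=\alpha}t^\alpha_{\beta,\gamma}\mu_\beta r_\gamma(\mu)$ with scalars $t^\alpha_{\beta,\gamma}$ determined by the comultiplication; $\Delta(x_i)=x_i\otimes1+g_i\otimes x_i$. Groups. $T\subseteq\Gamma$ is generated by the $g_i^N$, $\widehat T$ is its character group, and $\varphi:\mathbb CT\to\mathbb C^{\widehat T}$, $\varphi(x)(f)=f(x)$. $\mathrm{SO}_{\mathtt n}$ is the group of matrices $X$ with $\sum_kX_{kj}X_{k'i'}=\delta_{ij}$ and $\det X=1$; $B^+$ is its upper triangular subgroup, with coordinate functions $X_{ij}$. With $\ell_i=n_i/N$ and $\xi_i$ a primitive $\ell_i$-th root of unity, $\widehat T$ is described as generated by characters $\gamma_j$ with $\gamma_j(g_i^N)=\xi_j^{(2-\delta_{i,\theta})a_{ij}/2}$. $P_i\in B^+$ is the diagonal matrix with $(P_i)_{jj}=\xi_i$ if $j\in\{i+1,i'\}$ and $j\ne\theta+1$, $(P_i)_{jj}=\xi_i^{-1}$ if $j\in\{i,i'-1\}$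 and $j\ne\theta+1$, and $(P_i)_{jj}=1$ otherwise. For $\gamma=\gamma_1^{s_1}\cdots\gamma_\theta^{s_\theta}$ put $P_\gamma=P_1^{s_1}\cdots P_\theta^{s_\theta}$; $\gamma\mapsto P_\gamma$ is a group monomorphism $\widehat T\hookrightarrow B^+$. Then $\iota_\mu:\widehat T\hookrightarrow B^+$ is $\iota_\mu(\gamma)=Q_r^{-1}P_\gamma Q_r$, and $\iota_\mu^*:\mathcal O(B^+)\to\mathbb C^{\widehat T}$ is its comorphism. Quantum groups. Put $\rho_i=\mathtt n/2-i$ if $i<i'$, $\rho_{i'}=-\rho_i$ if $i\le i'$, $c_{ij}=\delta_{i,j'}q_1^{-\rho_i}$, $J=(c_{ij})$, and $R^{ij}_{ab}=q_1^{\delta_{ij}-\delta_{ij'}}\delta_{ia}\delta_{jb}+\mathsf u(i-a)(q_1-q_1^{-1})(\delta_{ja}\delta_{ib}-c_{ji}c_{ab})$ with $\mathsf u(x)=1$ if $x\ge1$ and $0$ otherwise. $\mathcal O_{q_1}(\mathrm{SO}_{\mathtt n})$ is generated by $z_{ij}$, $1\le i,j\le\mathtt n$, $\mathbf z=(z_{ij})$, with relations $\sum_{k,l}(R^{lk}_{ab}z_{ik}z_{jl}-R^{ji}_{kl}z_{ka}z_{lb})=0$ and $\mathbf zJ\mathbf z^tJ^{-1}=\mathrm{id}=J\mathbf z^tJ^{-1}\mathbf z$; $\mathcal O_{q_1}(B^+)$ is its quotient by the Hopf ideal generated by the $z_{ij}$, $i>j$, with $\Delta(z_{ij})=\sum_{k=i}^jz_{ik}\otimes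 z_{kj}$. The dual quantum Frobenius monomorphism $\iota:\mathcal O(B^+)\hookrightarrow\mathcal O_{q_1}(B^+)$ is $\iota(X_{ij})=\frac{(1+q_1)^N}2z_{ij}^N$ if $i<\theta+1<j$, and $\iota(X_{ij})=z_{ij}^N$ otherwise ($i\le j$). $U_q^Q(\mathfrak b^+)$ is the Hopf algebra generated by $K_{\alpha_i}^{\pm1}$, $E_i=E_{\alpha_i}$ with $K_{\alpha_i}E_jK_{\alpha_i}^{-1}=q^{d_ia_{ij}}E_j$, commuting $K$'s and the quantum Serre relations, $\Delta(E_i)=E_i\otimes1+K_{\alpha_i}\otimes E_i$, $K_{\alpha_i}$ group-like. The Hopf isomorphism $\psi:U_q^Q(\mathfrak b^+)\to\mathcal O_{q_1}(B^+)$ is $\psi(K_{\alpha_i}^{\pm1})=(z_{i'-1,i'-1}z_{ii})^{\pm1}$, $\psi(E_{\alpha_i})=q_1^{2-\delta_{i,\theta}}(q_1-q_1^{-1})^{-1}z_{i'-1,i'}z_{ii}$. Root vectors ($1\le i\le\theta$): $E_{i,i+1}=E_{\alpha_i}$; $E_{ij}=E_{j-1}E_{i,j-1}-q_1^{-1}E_{i,j-1}E_{j-1}$ for $i+1<j\le\theta+1$; $E_{ij}=E_{j'}E_{i,j-1}-q_1^{-1+\delta_{j,\theta+2}}E_{i,j-1}E_{j'}$ for $\theta+1<j\le i'-1$. $p:U_q^Q(\mathfrak b^+)\to u(\mathcal D_Q,\mu)$ is the Hopf epimorphism $K_{\alpha_i}\mapsto g_i$, $E_i\mapsto x_i$, and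 $p_\mu=p\circ\psi^{-1}:\mathcal O_{q_1}(B^+)\to u(\mathcal D_Q,\mu)$. The maps $\iota$, $\iota_\mu^*$, $p_\mu$ and the inclusion $\mathbb C^{\widehat T}\simeq\mathbb CT\subseteq u(\mathcal D_Q,\mu)$ (via $\varphi^{-1}$) form a commutative square, so that the power root vector relations are computed by $x_\alpha^N=p(E_\alpha^N)=\varphi^{-1}\iota_\mu^*(\psi(E_\alpha^N))$ (with $\mathcal O(B^+)$ identified with its image under $\iota$). Put $x_{(ij)}:=p_\mu(\psi(E_{ij}))=p(E_{ij})$, the root vector of $\alpha_{ij}$; $g_{(ij)}:=g_ig_{i+1}\cdots g_{j-1}$ for $i<j\le\theta+1$; $g_{(ij')}:=g_i\cdots g_{j-1}g_j^2\cdots g_\theta^2$ for $\theta+1<j'\le i'-1$.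
   Formalization: The factor (q_1-1)^N in r_{ji'} is corrected to (q_1+1)^N; P_gamma is replaced by its inverse so that the square commutes with K_i -> g_i; and r_alpha(mu) is defined by phi^{-1} iota_mu^*(psi(E_alpha^N)), as its schematic recursion has the opposite sign. *)

theory Defs
  imports
    "HOL-Library.Poly_Mapping"
    "Jordan_Normal_Form.Gauss_Jordan_Elimination"
    "Jordan_Normal_Form.Determinant"
begin

section \<open>Finitely presented associative algebras over the complex numbers\<close>

text \<open>The free algebra on \<open>'g\<close> is the monoid algebra of the free monoid, and an algebra
  presented by generators \<open>S\<close> and relators \<open>R\<close> is the subalgebra \<open>falg_on S\<close> of polynomials in
  the letters from \<open>S\<close> modulo \<open>alg_ideal S R\<close>. Elements of a presented algebra are written as
  elements of the free algebra, and equality in it is congruence modulo the ideal.\<close>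

datatype 'g word = Word (letters: "'g list")

instantiation word :: (type) monoid_add
begin

definition zero_word :: "'a word" where
  "zero_word = Word []"

definition plus_word :: "'a word \<Rightarrow> 'a word \<Rightarrow> 'a word" where
  "plus_word v w = Word (letters v @ letters w)"

instance
  by standard (simp_all add: zero_word_def plus_word_def)

end

type_synonym 'g falg = "'g word \<Rightarrow>\<^sub>0 complex"

definition gen :: "'g \<Rightarrow> 'g falg" where
  "gen x = Poly_Mapping.single (Word [x]) 1"

definition scal :: "complex \<Rightarrow> 'g falg" where
  "scal c = Poly_Mapping.single 0 c"

definition falg_on :: "'g set \<Rightarrow> 'g falg set" where
  "falg_on S = {a. \<forall>w\<in>Poly_Mapping.keys a. set (letters w) \<subseteq> S}"

inductive_set alg_ideal :: "'g set \<Rightarrow> 'g falg set \<Rightarrow> 'g falg set"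
  for S :: "'g set" and R :: "'g falg set" where
  zero: "0 \<in> alg_ideal S R"
| gen: "r \<in> R \<Longrightarrow> a \<in> falg_on S \<Longrightarrow> b \<in> falg_on S \<Longrightarrow> a * r * b \<in> alg_ideal S R"
| add: "a \<in> alg_ideal S R \<Longrightarrow> b \<in> alg_ideal S R \<Longrightarrow> a + b \<in> alg_ideal S R"

text \<open>The algebra homomorphism on the free algebra with prescribed values \<open>f\<close> on the letters;
  \<open>\<eta>\<close> embeds the scalars into the target algebra.\<close>

definition subst :: "(complex \<Rightarrow> 'r::ring_1) \<Rightarrow> ('g \<Rightarrow> 'r) \<Rightarrow> 'g falg \<Rightarrow> 'r" where
  "subst \<eta> f a = (\<Sum>w\<in>Poly_Mapping.keys a.
     \<eta> (Poly_Mapping.lookup a w) * prod_list (map f (letters w)))"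

abbreviation hom_ext :: "('g \<Rightarrow> 'h falg) \<Rightarrow> 'g falg \<Rightarrow> 'h falg" where
  "hom_ext \<equiv> subst scal"

abbreviation eval_at :: "('g \<Rightarrow> complex) \<Rightarrow> 'g falg \<Rightarrow> complex" where
  "eval_at \<equiv> subst (\<lambda>c. c)"

datatype Ugen = K_gen nat | Kinv_gen nat | E_gen nat

datatype ugen = g_gen nat | x_gen nat

context
  fixes \<theta> :: nat and N :: nat and nn :: "nat \<Rightarrow> nat" and q :: complex
begin

section \<open>Type B data\<close>

definition prm :: "nat \<Rightarrow> nat" where
  "prm k = 2 * \<theta> + 2 - k"

definition nB :: nat where
  "nB = 2 * \<theta> + 1"

definition q1 :: complex where
  "q1 = q ^ 2"

definition dB :: "nat \<Rightarrow> int" where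
  "dB i = (if i < \<theta> then 2 else 1)"

definition cartan :: "nat \<Rightarrow> nat \<Rightarrow> int" where
  "cartan i j =
     (if i = j then 2
      else if i = \<theta> \<and> j + 1 = \<theta> then -2
      else if i + 1 = j \<or> j + 1 = i then -1
      else 0)"

text \<open>The pair \<open>(i, j)\<close> stands for the root \<open>\<alpha>\<^sub>i\<^sub>j\<close>, and \<open>root_coeff i j k\<close> is the multiplicity
  of the simple root \<open>\<alpha>\<^sub>k\<close> in it.\<close>

definition pos_roots :: "(nat \<times> nat) set" where
  "pos_roots = {(i, j). 1 \<le> i \<and> i \<le> \<theta> \<and> i < j \<and> j \<le> prm i - 1}"

definition root_coeff :: "nat \<Rightarrow> nat \<Rightarrow> nat \<Rightarrow> nat" where
  "root_coeff i j k =
     (if j \<le> \<theta> + 1 then (if i \<le> k \<and> k < j then 1 else 0)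
      else if i \<le> k \<and> k < prm j then 1
      else if prm j \<le> k \<and> k \<le> \<theta> then 2
      else 0)"

definition chi :: "nat \<Rightarrow> nat \<Rightarrow> complex" where
  "chi j i = q powi (dB i * cartan i j)" \<comment> \<open>\<open>\<chi>\<^sub>j(g\<^sub>i)\<close>\<close>

text \<open>In \<open>\<Gamma>\<close>, \<open>\<Prod> g\<^sub>k\<^bsup>m\<^sub>k\<^esup> = 1\<close> means that \<open>n\<^sub>k\<close> divides \<open>m\<^sub>k\<close> for every \<open>k\<close>.\<close>

definition root_vector_params :: "(nat \<Rightarrow> nat \<Rightarrow> complex) \<Rightarrow> bool" where
  "root_vector_params \<mu> \<longleftrightarrow> (\<forall>(i, j)\<in>pos_roots.
     (\<forall>k\<in>{1..\<theta>}. nn k dvd N * root_coeff i j k) \<or>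
     (\<exists>m\<in>{1..\<theta>}. (\<Prod>k\<in>{1..\<theta>}. chi k m ^ root_coeff i j k) ^ N \<noteq> 1)
     \<longrightarrow> \<mu> i j = 0)"

section \<open>Root vectors of the quantized enveloping algebra\<close>

text \<open>The root vectors are written in the free algebra on the generators of \<open>U\<^sub>q\<^sup>Q(b\<^sup>+)\<close>; the maps
  \<open>p\<close> and \<open>\<psi>\<close> below are given by their values on these generators. The recursion is on the
  second index; its value for \<open>j \<le> i\<close> is irrelevant.\<close>

primrec rootE :: "nat \<Rightarrow> nat \<Rightarrow> Ugen falg" where
  "rootE i 0 = gen (E_gen i)"
| "rootE i (Suc j) =
     (if j \<le> i then gen (E_gen i)
      else if Suc j \<le> \<theta> + 1 then
        gen (E_gen j) * rootE i j - scal (inverse q1) * rootE i j * gen (E_gen j)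
      else
        gen (E_gen (prm (Suc j))) * rootE i j
        - scal (q1 powi (-1 + of_bool (Suc j = \<theta> + 2))) * rootE i j * gen (E_gen (prm (Suc j))))"

section \<open>Quantum groups\<close>

text \<open>\<open>2 * \<rho>\<^sub>i\<close>, an integer; hence \<open>q\<^sub>1\<^bsup>-\<rho>\<^sub>i\<^esup> = q\<^bsup>-2\<rho>\<^sub>i\<^esup>\<close> by the choice \<open>q\<^sub>1\<^bsup>1/2\<^esup> = q\<close>.\<close>

definition two_rho :: "nat \<Rightarrow> int" where
  "two_rho i =
     (if i < prm i then int nB - 2 * int i
      else - (if prm i = i then 0 else int nB - 2 * int (prm i)))"

definition cJ :: "nat \<Rightarrow> nat \<Rightarrow> complex" where
  "cJ i j = (if i = prm j then q powi (- two_rho i) else 0)"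

definition Rmat :: "nat \<Rightarrow> nat \<Rightarrow> nat \<Rightarrow> nat \<Rightarrow> complex" where
  "Rmat i j a b =
     q1 powi (of_bool (i = j) - of_bool (i = prm j)) * of_bool (i = a) * of_bool (j = b)
     + of_bool (i > a) * (q1 - inverse q1) *
         (of_bool (j = a) * of_bool (i = b) - cJ j i * cJ a b)" \<comment> \<open>\<open>R\<^sup>i\<^sup>j\<^sub>a\<^sub>b\<close>\<close>

definition zg :: "nat \<Rightarrow> nat \<Rightarrow> (nat \<times> nat) falg" where
  "zg i j = gen (i, j)"

text \<open>The matrix \<open>J = (cJ i j)\<close> is its own inverse, because \<open>\<rho>\<^bsub>i'\<^esub> = -\<rho>\<^sub>i\<close>; therefore \<open>cJ\<close> also
  appears in place of \<open>J\<^sup>-\<^sup>1\<close> in the orthogonality relations.\<close>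

definition OqSO_rels :: "(nat \<times> nat) falg set" where
  "OqSO_rels =
     {(\<Sum>k\<in>{1..nB}. \<Sum>l\<in>{1..nB}.
          scal (Rmat l k a b) * zg i k * zg j l - scal (Rmat j i k l) * zg k a * zg l b)
       | i j a b. i \<in> {1..nB} \<and> j \<in> {1..nB} \<and> a \<in> {1..nB} \<and> b \<in> {1..nB}}
   \<union> {(\<Sum>a\<in>{1..nB}. \<Sum>b\<in>{1..nB}. \<Sum>c\<in>{1..nB}.
          scal (cJ a b * cJ c j) * zg i a * zg c b) - of_bool (i = j)
       | i j. i \<in> {1..nB} \<and> j \<in> {1..nB}}
   \<union> {(\<Sum>a\<in>{1..nB}. \<Sum>b\<in>{1..nB}. \<Sum>c\<in>{1..nB}.
          scal (cJ i a * cJ b c) * zg b a * zg c j) - of_bool (i = j)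
       | i j. i \<in> {1..nB} \<and> j \<in> {1..nB}}"

definition OqB_ideal :: "(nat \<times> nat) falg set" where
  "OqB_ideal = alg_ideal ({1..nB} \<times> {1..nB})
     (OqSO_rels \<union> {zg i j | i j. i \<in> {1..nB} \<and> j \<in> {1..nB} \<and> i > j})"

text \<open>The inverse of \<open>z\<^bsub>i'-1,i'-1\<^esub> z\<^sub>i\<^sub>i\<close> is \<open>z\<^bsub>i'i'\<^esub> z\<^bsub>i+1,i+1\<^esub>\<close>, since
  \<open>z\<^sub>k\<^sub>k z\<^bsub>k'k'\<^esub> = 1\<close> in \<open>O\<^bsub>q\<^sub>1\<^esub>(B\<^sup>+)\<close>.\<close>

fun psi_gen :: "Ugen \<Rightarrow> (nat \<times> nat) falg" where
  "psi_gen (K_gen i) = zg (prm i - 1) (prm i - 1) * zg i i"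
| "psi_gen (Kinv_gen i) = zg (prm i) (prm i) * zg (i + 1) (i + 1)"
| "psi_gen (E_gen i) = scal (q1 ^ (2 - of_bool (i = \<theta>)) * inverse (q1 - inverse q1))
     * zg (prm i - 1) (prm i) * zg i i"

section \<open>The classical Borel subgroup and the quantum Frobenius map\<close>

text \<open>Matrices of \<^typ>\<open>complex mat\<close> are indexed from \<open>0\<close>, the mathematical indices from \<open>1\<close>.\<close>

definition entry :: "complex mat \<Rightarrow> nat \<times> nat \<Rightarrow> complex" where
  "entry A = (\<lambda>(i, j). A $$ (i - 1, j - 1))"

definition SO :: "complex mat set" where
  "SO = {A \<in> carrier_mat nB nB.
     (\<forall>i\<in>{1..nB}. \<forall>j\<in>{1..nB}.
        (\<Sum>k\<in>{1..nB}. entry A (k, j) * entry A (prm k, prm i)) = of_bool (i = j))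
     \<and> det A = 1}"

definition Bplus :: "complex mat set" where
  "Bplus = {A \<in> SO. upper_triangular A}"

text \<open>A regular function on \<open>B\<^sup>+\<close> is given by a polynomial in the coordinates \<open>X\<^sub>i\<^sub>j\<close>, \<open>i \<le> j\<close>,
  and \<open>frob_gen\<close> gives the values of \<open>\<iota>\<close> on these coordinates.\<close>

definition Bplus_coords :: "(nat \<times> nat) set" where
  "Bplus_coords = {(i, j). 1 \<le> i \<and> i \<le> j \<and> j \<le> nB}"

definition frob_gen :: "nat \<times> nat \<Rightarrow> (nat \<times> nat) falg" where
  "frob_gen = (\<lambda>(i, j).
     scal (if i < \<theta> + 1 \<and> \<theta> + 1 < j then (1 + q1) ^ N / 2 else 1) * zg i j ^ N)"

section \<open>The matrix of the root vector parameters\<close>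

text \<open>The factor \<open>(q\<^sub>1 + 1)\<^sup>N / 2\<close> in the second family of entries is the one by which \<open>\<iota>\<close> rescales
  \<open>z\<^bsub>ji'\<^esub>\<^sup>N\<close> for \<open>j < \<theta> + 1 < i'\<close>, and \<open>(-1)\<^bsup>\<theta>+1-j\<^esup> / (q\<^sub>1\<^sup>2 - 1)\<close> is, up to a power of \<open>q\<close>, the coefficient of
  \<open>z\<^bsub>ji'\<^esub> z\<^sub>i\<^sub>i\<close> in \<open>\<psi>(E\<^bsub>ij'\<^esub>)\<close>; with these normalizations \<open>\<mu>\<^bsub>ij'\<^esub>\<close> is the coefficient of \<open>g\<^bsub>(ij')\<^esub>\<^sup>N - 1\<close>
  in the relation for \<open>\<alpha>\<^bsub>ij'\<^esub>\<close>.\<close>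

definition is_Qr :: "(nat \<Rightarrow> nat \<Rightarrow> complex) \<Rightarrow> complex mat \<Rightarrow> bool" where
  "is_Qr \<mu> Q \<longleftrightarrow>
     Q \<in> Bplus \<and> (\<forall>i\<in>{1..nB}. entry Q (i, i) = 1) \<and>
     (\<forall>i j. 1 \<le> i \<and> i < j \<and> j \<le> \<theta> + 1 \<longrightarrow>
        entry Q (prm j, prm i) = (q1\<^sup>2 - 1) ^ N * \<mu> i j \<and>
        (j \<noteq> \<theta> + 1 \<longrightarrow>
           entry Q (j, prm i)
             = (-1) ^ (\<theta> + 1 - j) * (1 / 2) * (q1\<^sup>2 - 1) ^ N * (q1 + 1) ^ N * \<mu> i (prm j)))"

definition Qr :: "(nat \<Rightarrow> nat \<Rightarrow> complex) \<Rightarrow> complex mat" where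
  "Qr \<mu> = (THE Q. is_Qr \<mu> Q)" \<comment> \<open>existence and uniqueness: \<open>ex1_is_Qr\<close>\<close>

definition r_entry :: "(nat \<Rightarrow> nat \<Rightarrow> complex) \<Rightarrow> nat \<Rightarrow> nat \<Rightarrow> complex" where
  "r_entry \<mu> a b = entry (Qr \<mu>) (a, b)"

section \<open>The characters of T and their embedding into the Borel subgroup\<close>

text \<open>\<open>T\<close> is the direct product of the cyclic groups generated by \<open>g\<^sub>i\<^sup>N\<close>, of order \<open>n\<^sub>i / N\<close>;
  a character is given by its values \<open>\<gamma> i\<close> on \<open>g\<^sub>i\<^sup>N\<close>.\<close>

definition T_hat :: "(nat \<Rightarrow> complex) set" where
  "T_hat = {\<gamma>. \<forall>i\<in>{1..\<theta>}. \<gamma> i ^ (nn i div N) = 1}"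

text \<open>\<open>P_mat \<gamma>\<close> is the diagonal matrix in the maximal torus of \<open>SO\<close> on which the coordinate function
  \<open>X\<^bsub>i'-1,i'-1\<^esub> X\<^sub>i\<^sub>i\<close>, that is \<open>\<psi>(K\<^sub>i)\<^sup>N\<close>, takes the value \<open>\<gamma>(g\<^sub>i\<^sup>N)\<close>. In terms of
  generating characters \<open>\<gamma>\<^sub>j\<close> and of the diagonal matrices \<open>P\<^sub>j\<close> with entries \<open>\<xi>\<^sub>j\<^bsup>\<plusminus>1\<^esup>\<close> see
  \<open>torus_entry_generator\<close> below.\<close>

definition torus_entry :: "(nat \<Rightarrow> complex) \<Rightarrow> nat \<Rightarrow> complex" where
  "torus_entry \<gamma> i =
     (if i \<le> \<theta> then (\<Prod>k\<in>{i..\<theta>}. \<gamma> k)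
      else if i = \<theta> + 1 then 1
      else inverse (\<Prod>k\<in>{prm i..\<theta>}. \<gamma> k))"

definition P_mat :: "(nat \<Rightarrow> complex) \<Rightarrow> complex mat" where
  "P_mat \<gamma> = mat nB nB (\<lambda>(i, j). if i = j then torus_entry \<gamma> (i + 1) else 0)"

definition iota_mu :: "(nat \<Rightarrow> nat \<Rightarrow> complex) \<Rightarrow> (nat \<Rightarrow> complex) \<Rightarrow> complex mat" where
  "iota_mu \<mu> \<gamma> = the (mat_inverse (Qr \<mu>)) * P_mat \<gamma> * Qr \<mu>"

section \<open>The pointed Hopf algebra\<close>

text \<open>The inverse of \<open>g\<^sub>i\<close> is \<open>g\<^sub>i\<^bsup>n\<^sub>i-1\<^esup>\<close>. In the bosonization the braided adjoint action of
  \<open>x\<^sub>i\<close> is \<open>y \<mapsto> x\<^sub>i y - (g\<^sub>i y g\<^sub>i\<^sup>-\<^sup>1) x\<^sub>i\<close>.\<close>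

definition ad_c :: "nat \<Rightarrow> ugen falg \<Rightarrow> ugen falg" where
  "ad_c i y = gen (x_gen i) * y - gen (g_gen i) * y * gen (g_gen i) ^ (nn i - 1) * gen (x_gen i)"

fun p_gen :: "Ugen \<Rightarrow> ugen falg" where
  "p_gen (K_gen i) = gen (g_gen i)"
| "p_gen (Kinv_gen i) = gen (g_gen i) ^ (nn i - 1)"
| "p_gen (E_gen i) = gen (x_gen i)"

definition x_root :: "nat \<Rightarrow> nat \<Rightarrow> ugen falg" where
  "x_root i j = hom_ext p_gen (rootE i j)"

text \<open>An element \<open>t\<close> of the group algebra of \<open>T\<close> is written as a polynomial in letters
  \<open>i \<in> {1..\<theta>}\<close> standing for \<open>g\<^sub>i\<^sup>N\<close>.\<close>

definition incl_T :: "nat falg \<Rightarrow> ugen falg" where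
  "incl_T = hom_ext (\<lambda>i. gen (g_gen i) ^ N)"

text \<open>\<open>is_r \<mu> i j t\<close>: the element \<open>t\<close> of the group algebra of \<open>T\<close> is
  \<open>r\<^sub>\<alpha>(\<mu>) = \<phi>\<^sup>-\<^sup>1(\<iota>\<^sub>\<mu>\<^sup>*(f))\<close> for \<open>\<alpha> = \<alpha>\<^sub>i\<^sub>j\<close>, where \<open>f\<close> is the regular function on \<open>B\<^sup>+\<close>
  with \<open>\<iota>(f) = \<psi>(E\<^sub>i\<^sub>j\<^sup>N)\<close>.\<close>

definition is_r :: "(nat \<Rightarrow> nat \<Rightarrow> complex) \<Rightarrow> nat \<Rightarrow> nat \<Rightarrow> nat falg \<Rightarrow> bool" where
  "is_r \<mu> i j t \<longleftrightarrow> t \<in> falg_on {1..\<theta>} \<and>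
     (\<exists>f \<in> falg_on Bplus_coords.
        hom_ext frob_gen f - hom_ext psi_gen (rootE i j ^ N) \<in> OqB_ideal \<and>
        (\<forall>\<gamma>\<in>T_hat. eval_at \<gamma> t = eval_at (entry (iota_mu \<mu> \<gamma>)) f))"

definition u_gens :: "ugen set" where
  "u_gens = g_gen ` {1..\<theta>} \<union> x_gen ` {1..\<theta>}"

definition u_rels :: "(nat \<Rightarrow> nat \<Rightarrow> complex) \<Rightarrow> ugen falg set" where
  "u_rels \<mu> =
     {gen (g_gen i) * gen (g_gen j) - gen (g_gen j) * gen (g_gen i) | i j. i \<in> {1..\<theta>} \<and> j \<in> {1..\<theta>}}
   \<union> {gen (g_gen i) ^ nn i - 1 | i. i \<in> {1..\<theta>}}
   \<union> {gen (g_gen i) * gen (x_gen j) - scal (chi j i) * gen (x_gen j) * gen (g_gen i)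
       | i j. i \<in> {1..\<theta>} \<and> j \<in> {1..\<theta>}}
   \<union> {(ad_c i ^^ nat (1 - cartan i j)) (gen (x_gen j))
       | i j. i \<in> {1..\<theta>} \<and> j \<in> {1..\<theta>} \<and> i \<noteq> j}
   \<union> {x_root i j ^ N - incl_T t | i j t. (i, j) \<in> pos_roots \<and> is_r \<mu> i j t}"

definition u_eq :: "(nat \<Rightarrow> nat \<Rightarrow> complex) \<Rightarrow> ugen falg \<Rightarrow> ugen falg \<Rightarrow> bool" where
  "u_eq \<mu> a b \<longleftrightarrow> a - b \<in> alg_ideal u_gens (u_rels \<mu>)"

text \<open>\<open>g_lo i j\<close> is \<open>g\<^bsub>(ij)\<^esub>\<close>, and \<open>g_hi i j\<close> is \<open>g\<^bsub>(ij')\<^esub>\<close>.\<close>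

definition g_lo :: "nat \<Rightarrow> nat \<Rightarrow> ugen falg" where
  "g_lo i j = prod_list (map (\<lambda>k. gen (g_gen k)) [i..<j])"

definition g_hi :: "nat \<Rightarrow> nat \<Rightarrow> ugen falg" where
  "g_hi i j = g_lo i j * prod_list (map (\<lambda>k. gen (g_gen k) ^ 2) [j..<\<theta> + 1])"

section \<open>Consistency of the conventions\<close>

lemma cJ_involutive:
  assumes "q \<noteq> 0" "i \<in> {1..nB}" "j \<in> {1..nB}"
  shows "(\<Sum>k\<in>{1..nB}. cJ i k * cJ k j) = of_bool (i = j)"
proof -
  have b: "prm i \<in> {1..nB}" "prm (prm i) = i" "prm (prm j) = j"
    using assms(2,3) by (auto simp: prm_def nB_def)
  have r: "two_rho (prm i) = - two_rho i"
    using assms(2) b by (auto simp: two_rho_def prm_def nB_def)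
  have "(\<Sum>k\<in>{1..nB}. cJ i k * cJ k j) = (\<Sum>k\<in>{prm i}. cJ i k * cJ k j)"
  proof (rule sum.mono_neutral_right)
    show "\<forall>k\<in>{1..nB} - {prm i}. cJ i k * cJ k j = 0"
      by (auto simp: cJ_def prm_def nB_def)
  qed (use b in auto)
  also have "\<dots> = of_bool (i = j)"
  proof (cases "i = j")
    case True
    have "q powi (- two_rho i) * q powi (two_rho i) = 1"
      using assms(1) by (simp add: power_int_minus)
    then show ?thesis using True b r by (simp add: cJ_def)
  next
    case False
    then have "prm i \<noteq> prm j" using b by metis
    then show ?thesis using False by (simp add: cJ_def)
  qed
  finally show ?thesis .
qed

text \<open>With a root of unity \<open>\<xi>\<close> let \<open>\<gamma>\<^sub>j(g\<^sub>i\<^sup>N) = \<xi>\<^bsup>(2-\<delta>)a\<^sub>i\<^sub>j/2\<^esup>\<close>, where \<open>\<delta> = \<delta>\<^bsub>i,\<theta>\<^esub>\<close>. Let \<open>P\<^sub>j\<close> be the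
  diagonal matrix with entries \<open>\<xi>\<close> at \<open>j+1, j'\<close>, \<open>\<xi>\<^sup>-\<^sup>1\<close> at \<open>j, j'-1\<close>, and \<open>1\<close> elsewhere and at
  \<open>\<theta>+1\<close>. On \<open>P\<^sub>j\<close> the function \<open>X\<^bsub>i'-1,i'-1\<^esub> X\<^sub>i\<^sub>i\<close> has the value \<open>\<gamma>\<^sub>j(g\<^sub>i\<^sup>N)\<^sup>-\<^sup>1\<close>, so that the
  matrix belonging to \<open>\<gamma>\<^sub>j\<close> under \<open>\<psi>(K\<^sub>i) \<mapsto> g\<^sub>i\<close> is \<open>P\<^sub>j\<^sup>-\<^sup>1\<close>.\<close>

lemma torus_entry_generator:
  assumes "\<xi> \<noteq> 0" "j \<in> {1..\<theta>}" "k \<in> {1..nB}"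
    and \<gamma>: "\<And>i. i \<in> {1..\<theta>} \<Longrightarrow> \<gamma> i = \<xi> powi ((2 - of_bool (i = \<theta>)) * cartan i j div 2)"
  shows "torus_entry \<gamma> k = inverse
    (if k = \<theta> + 1 then 1
     else if k = j + 1 \<or> k = prm j then \<xi>
     else if k = j \<or> k = prm j - 1 then inverse \<xi>
     else 1)"
proof -
  have *: "(\<Prod>m\<in>{i..\<theta>}. \<gamma> m) =
      (if i = j then \<xi> else if i = j + 1 \<and> i \<le> \<theta> then inverse \<xi> else 1)"
    if "1 \<le> i" "i \<le> Suc \<theta>" for i
    using that(2,1)
  proof (induction i rule: inc_induct)
    case base
    then show ?case using assms(2) by auto
  next
    case (step i)
    have "{i..\<theta>} = insert i {Suc i..\<theta>}" using step.hyps by auto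
    then have "(\<Prod>m\<in>{i..\<theta>}. \<gamma> m) = \<gamma> i * (\<Prod>m\<in>{Suc i..\<theta>}. \<gamma> m)" by simp
    moreover have "\<gamma> i = \<xi> powi ((2 - of_bool (i = \<theta>)) * cartan i j div 2)"
      using \<gamma> step by auto
    ultimately show ?case
      using step assms(1,2) by (auto simp: cartan_def power_int_minus power2_eq_square)
  qed
  have k: "1 \<le> k" "k \<le> 2 * \<theta> + 1" using assms(3) by (auto simp: nB_def)
  consider "k \<le> \<theta>" | "k = \<theta> + 1" | "k > \<theta> + 1" by linarith
  then show ?thesis
  proof cases
    case 1
    then show ?thesis using *[of k] k assms(1,2) by (auto simp: torus_entry_def prm_def)
  next
    case 2
    then show ?thesis by (simp add: torus_entry_def)
  next
    case 3
    then show ?thesis using *[of "prm k"] k assms(1,2)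
      by (auto simp: torus_entry_def prm_def)
  qed
qed

text \<open>The prescribed entries are those above the diagonal with \<open>i + j > 2\<theta> + 2\<close>; the others are
  determined by the orthogonality relations.\<close>

context
  fixes v :: "nat \<Rightarrow> nat \<Rightarrow> complex"
begin

function ext :: "nat \<Rightarrow> nat \<Rightarrow> complex" where
  "ext i j =
     (if j < i \<or> j > nB then 0
      else if i = j then 1
      else if i + j > 2 * \<theta> + 2 then v i j
      else - (\<Sum>k\<in>{i<..<j}. ext k j * ext (prm k) (prm i)) /
             (if i + j = 2 * \<theta> + 2 then 2 else 1)
           - (if i + j = 2 * \<theta> + 2 then 0 else v (prm j) (prm i)))"
  by auto
termination
  by (relation "measure (\<lambda>(i, j). j - i)") (auto simp: prm_def nB_def)

declare ext.simps [simp del]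

lemma ext_orthogonal:
  assumes "i \<in> {1..nB}" "j \<in> {1..nB}"
  shows "(\<Sum>k\<in>{1..nB}. ext k j * ext (prm k) (prm i)) = of_bool (i = j)"
proof -
  have low: "ext a b = 0" if "b < a" for a b using that by (subst ext.simps) auto
  have diag: "ext a a = 1" if "a \<le> nB" for a using that by (subst ext.simps) auto
  have "(\<Sum>k\<in>{1..nB}. ext k j * ext (prm k) (prm i)) =
        (\<Sum>k\<in>{i..j}. ext k j * ext (prm k) (prm i))"
    using assms by (intro sum.mono_neutral_right)
      (auto simp: prm_def nB_def not_le intro!: low)
  also have "\<dots> = of_bool (i = j)"
  proof -
    define S where "S a b = (\<Sum>k\<in>{a<..<b}. ext k b * ext (prm k) (prm a))" for a b
    have S_sym: "S (prm j) (prm i) = S i j"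
      unfolding S_def
      by (rule sum.reindex_bij_witness[of _ prm prm])
        (use assms in \<open>auto simp: prm_def nB_def mult.commute\<close>)
    consider "i > j" | "i = j" | "i < j" by linarith
    then show ?thesis
    proof cases
      case 3
      have "{i..j} = insert i (insert j {i<..<j})" using 3 by auto
      then have "(\<Sum>k\<in>{i..j}. ext k j * ext (prm k) (prm i)) =
          ext i j + ext (prm j) (prm i) + S i j"
        using 3 assms by (simp add: S_def diag prm_def nB_def)
      also have "\<dots> = 0"
      proof -
        have p: "prm (prm i) = i" "prm (prm j) = j" "prm j < prm i" "prm i \<le> nB" "prm j \<le> nB"
          "prm j + prm i = 4 * \<theta> + 4 - (i + j)"
          using 3 assms by (auto simp: prm_def nB_def)
        consider "i + j = 2 * \<theta> + 2" | "i + j > 2 * \<theta> + 2" | "i + j < 2 * \<theta> + 2" by linarith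
        then show ?thesis
        proof cases
          case 1
          then have "prm j = i" "prm i = j" using assms by (auto simp: prm_def)
          moreover have "ext i j = - S i j / 2"
            using 1 3 assms by (subst ext.simps) (auto simp: S_def)
          ultimately show ?thesis by simp
        next
          case 2
          have "ext i j = v i j" using 2 3 assms by (subst ext.simps) auto
          moreover have "ext (prm j) (prm i) = - S (prm j) (prm i) - v i j"
            using 2 3 p by (subst ext.simps) (auto simp: S_def)
          ultimately show ?thesis using S_sym by simp
        next
          case c: 3
          have "ext i j = - S i j - v (prm j) (prm i)"
            using c 3 assms by (subst ext.simps) (auto simp: S_def)
          moreover have "ext (prm j) (prm i) = v (prm j) (prm i)"
            using c 3 p assms by (subst ext.simps) (auto simp: prm_def nB_def)
          ultimately show ?thesis by simp
        qed
      qed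
      finally show ?thesis using 3 by simp
    qed (use assms in \<open>auto simp: diag prm_def nB_def\<close>)
  qed
  finally show ?thesis .
qed

end

text \<open>The values \<open>v i j\<close>, \<open>i + j > 2\<theta> + 2\<close>, prescribed by \<open>\<mu>\<close>.\<close>

definition Qr_value :: "(nat \<Rightarrow> nat \<Rightarrow> complex) \<Rightarrow> nat \<Rightarrow> nat \<Rightarrow> complex" where
  "Qr_value \<mu> a b = (if a \<ge> \<theta> + 1 then (q1\<^sup>2 - 1) ^ N * \<mu> (prm b) (prm a)
    else (-1) ^ (\<theta> + 1 - a) * (1 / 2) * (q1\<^sup>2 - 1) ^ N * (q1 + 1) ^ N * \<mu> (prm b) (prm a))"

lemma is_Qr_exists: "\<exists>Q. is_Qr \<mu> Q"
proof -
  define v where "v = Qr_value \<mu>"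
  define Q where "Q = mat nB nB (\<lambda>(i, j). ext v (i + 1) (j + 1))"
  have low: "ext v a b = 0" if "b < a" for a b using that by (subst ext.simps) auto
  have diag: "ext v a a = 1" if "a \<le> nB" for a using that by (subst ext.simps) auto
  have pre: "ext v a b = v a b" if "a < b" "b \<le> nB" "a + b > 2 * \<theta> + 2" for a b
    using that by (subst ext.simps) auto
  have ent: "entry Q (i, j) = ext v i j" if "i \<in> {1..nB}" "j \<in> {1..nB}" for i j
    using that by (auto simp: entry_def Q_def)
  have car: "Q \<in> carrier_mat nB nB" by (simp add: Q_def)
  have up: "upper_triangular Q" by (auto simp: Q_def low)
  have "det Q = 1"
  proof -
    have "diag_mat Q = map (\<lambda>_. 1) [0..<nB]"
      by (auto simp: diag_mat_def Q_def diag intro!: map_cong)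
    then show ?thesis using det_upper_triangular[OF up car] by (simp add: map_replicate_const prod_list_replicate)
  qed
  moreover have "(\<Sum>k\<in>{1..nB}. entry Q (k, j) * entry Q (prm k, prm i)) = of_bool (i = j)"
    if "i \<in> {1..nB}" "j \<in> {1..nB}" for i j
  proof -
    have "(\<Sum>k\<in>{1..nB}. entry Q (k, j) * entry Q (prm k, prm i)) =
        (\<Sum>k\<in>{1..nB}. ext v k j * ext v (prm k) (prm i))"
      using that by (intro sum.cong refl) (subst (1 2) ent, auto simp: prm_def nB_def)
    then show ?thesis using ext_orthogonal[OF that, of v] by simp
  qed
  ultimately have "Q \<in> Bplus" using car up by (auto simp: Bplus_def SO_def)
  moreover have "entry Q (i, i) = 1" if "i \<in> {1..nB}" for i
    using that by (simp add: ent diag)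
  moreover have "entry Q (prm j, prm i) = (q1\<^sup>2 - 1) ^ N * \<mu> i j"
    if "1 \<le> i" "i < j" "j \<le> \<theta> + 1" for i j
  proof -
    have "entry Q (prm j, prm i) = v (prm j) (prm i)"
      using that by (subst ent) (auto simp: prm_def nB_def intro!: pre)
    then show ?thesis using that by (auto simp: v_def Qr_value_def prm_def)
  qed
  moreover have "entry Q (j, prm i)
      = (-1) ^ (\<theta> + 1 - j) * (1 / 2) * (q1\<^sup>2 - 1) ^ N * (q1 + 1) ^ N * \<mu> i (prm j)"
    if "1 \<le> i" "i < j" "j \<le> \<theta>" for i j
  proof -
    have "entry Q (j, prm i) = v j (prm i)"
      using that by (subst ent) (auto simp: prm_def nB_def intro!: pre)
    then show ?thesis using that by (auto simp: v_def Qr_value_def prm_def)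
  qed
  ultimately have "is_Qr \<mu> Q" unfolding is_Qr_def by auto
  then show ?thesis ..
qed

lemma is_Qr_entry:
  assumes "is_Qr \<mu> Q" "i \<in> {1..nB}" "j \<in> {1..nB}"
  shows "entry Q (i, j) = ext (Qr_value \<mu>) i j"
  using assms(2,3)
proof (induction "j - i" arbitrary: i j rule: less_induct)
  case less
  have Q: "Q \<in> carrier_mat nB nB" "upper_triangular Q"
      "\<And>i. i \<in> {1..nB} \<Longrightarrow> entry Q (i, i) = 1"
    and orth: "\<And>i j. i \<in> {1..nB} \<Longrightarrow> j \<in> {1..nB} \<Longrightarrow>
      (\<Sum>k\<in>{1..nB}. entry Q (k, j) * entry Q (prm k, prm i)) = of_bool (i = j)"
    and lo: "\<And>i j. 1 \<le> i \<Longrightarrow> i < j \<Longrightarrow> j \<le> \<theta> + 1 \<Longrightarrow>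
      entry Q (prm j, prm i) = (q1\<^sup>2 - 1) ^ N * \<mu> i j"
    and hi: "\<And>i j. 1 \<le> i \<Longrightarrow> i < j \<Longrightarrow> j \<le> \<theta> \<Longrightarrow> entry Q (j, prm i)
      = (-1) ^ (\<theta> + 1 - j) * (1 / 2) * (q1\<^sup>2 - 1) ^ N * (q1 + 1) ^ N * \<mu> i (prm j)"
    using assms(1) unfolding is_Qr_def Bplus_def SO_def by auto
  have low: "entry Q (a, b) = 0" if "b < a" "a \<in> {1..nB}" "b \<in> {1..nB}" for a b
  proof -
    have "b - 1 < a - 1" "a - 1 < dim_row Q" using that Q(1) by auto
    then show ?thesis using Q(2) by (simp add: entry_def upper_triangular_def)
  qed
  have pre: "entry Q (a, b) = Qr_value \<mu> a b"
    if "a < b" "1 \<le> a" "b \<le> nB" "a + b > 2 * \<theta> + 2" for a b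
  proof (cases "a \<ge> \<theta> + 1")
    case True
    then show ?thesis using lo[of "prm b" "prm a"] that
      by (auto simp: Qr_value_def prm_def nB_def)
  next
    case False
    then show ?thesis using hi[of "prm b" a] that
      by (auto simp: Qr_value_def prm_def nB_def)
  qed
  consider "j < i" | "i = j" | "i < j" "i + j > 2 * \<theta> + 2" | "i < j" "i + j \<le> 2 * \<theta> + 2"
    by linarith
  then show ?case
  proof cases
    case 1
    then show ?thesis using low less.prems by (subst ext.simps) auto
  next
    case 2
    then show ?thesis using Q(3) less.prems by (subst ext.simps) auto
  next
    case 3
    then show ?thesis using pre less.prems by (subst ext.simps) auto
  next
    case 4
    define S where "S = (\<Sum>k\<in>{i<..<j}. ext (Qr_value \<mu>) k j * ext (Qr_value \<mu>) (prm k) (prm i))"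
    have "(\<Sum>k\<in>{1..nB}. entry Q (k, j) * entry Q (prm k, prm i)) =
        (\<Sum>k\<in>{i..j}. entry Q (k, j) * entry Q (prm k, prm i))"
    proof (intro sum.mono_neutral_right ballI)
      fix k assume "k \<in> {1..nB} - {i..j}"
      then have "j < k \<or> prm i < prm k" "k \<in> {1..nB}" "prm k \<in> {1..nB}" "prm i \<in> {1..nB}"
        using less.prems by (auto simp: prm_def nB_def)
      then show "entry Q (k, j) * entry Q (prm k, prm i) = 0"
        using low[of j k] low[of "prm i" "prm k"] less.prems by auto
    qed (use less.prems in auto)
    moreover have "{i..j} = insert i (insert j {i<..<j})" using 4 by auto
    moreover have "(\<Sum>k\<in>{i<..<j}. entry Q (k, j) * entry Q (prm k, prm i)) = S"
      unfolding S_def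
    proof (intro sum.cong refl)
      fix k assume k: "k \<in> {i<..<j}"
      have "entry Q (k, j) = ext (Qr_value \<mu>) k j"
        using k less.prems by (intro less.hyps) auto
      moreover have "entry Q (prm k, prm i) = ext (Qr_value \<mu>) (prm k) (prm i)"
        using k less.prems by (intro less.hyps) (auto simp: prm_def nB_def)
      ultimately show "entry Q (k, j) * entry Q (prm k, prm i) =
        ext (Qr_value \<mu>) k j * ext (Qr_value \<mu>) (prm k) (prm i)" by simp
    qed
    moreover have "prm i \<in> {1..nB}" using less.prems by (auto simp: prm_def nB_def)
    ultimately have eq: "entry Q (i, j) + entry Q (prm j, prm i) + S = 0"
      using orth[of i j] 4 less.prems Q(3)[of j] Q(3)[of "prm i"] by (simp add: add.assoc)
    show ?thesis
    proof (cases "i + j = 2 * \<theta> + 2")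
      case True
      then have "prm j = i" "prm i = j" by (auto simp: prm_def)
      then have "entry Q (i, j) = - S / 2" using eq by (simp add: field_simps eq_neg_iff_add_eq_0)
      then show ?thesis using True 4 less.prems by (subst ext.simps) (auto simp: S_def)
    next
      case False
      then have "entry Q (prm j, prm i) = Qr_value \<mu> (prm j) (prm i)"
        using 4 less.prems by (intro pre) (auto simp: prm_def nB_def)
      then have "entry Q (i, j) = - S - Qr_value \<mu> (prm j) (prm i)"
        using eq by (simp add: algebra_simps eq_neg_iff_add_eq_0)
      then show ?thesis using False 4 less.prems by (subst ext.simps) (auto simp: S_def)
    qed
  qed
qed

lemma ex1_is_Qr: "\<exists>!Q. is_Qr \<mu> Q"
proof (rule ex_ex1I[OF is_Qr_exists])
  fix Q Q' assume Q: "is_Qr \<mu> Q" "is_Qr \<mu> Q'"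
  then have car: "Q \<in> carrier_mat nB nB" "Q' \<in> carrier_mat nB nB"
    by (auto simp: is_Qr_def Bplus_def SO_def)
  show "Q = Q'"
  proof (rule eq_matI)
    fix i j assume "i < dim_row Q'" "j < dim_col Q'"
    then have "entry Q (i + 1, j + 1) = entry Q' (i + 1, j + 1)"
      using is_Qr_entry[OF Q(1)] is_Qr_entry[OF Q(2)] car by simp
    then show "Q $$ (i, j) = Q' $$ (i, j)" by (simp add: entry_def)
  qed (use car in auto)
qed

lemma is_Qr_Qr: "is_Qr \<mu> (Qr \<mu>)"
  unfolding Qr_def by (rule theI'[OF ex1_is_Qr])

end

end

theory Submission
  imports Defs
begin

text \<open>In \<open>O\<^bsub>q\<^sub>1\<^esub>(B\<^sup>+)\<close> each step of the recursion for the root vectors is one skew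
  commutator of two matrix entries, so by induction \<open>\<psi>(E\<^sub>i\<^sub>j)\<close> is a multiple of
  \<open>z\<^bsub>j'i'\<^esub> z\<^sub>i\<^sub>i\<close>, for all \<open>i < j < i'\<close>. These two factors commute up to \<open>q\<^sub>1\<close>, hence the \<open>N\<close>-th
  power is the image under \<open>\<iota>\<close> of a multiple of \<open>X\<^bsub>j'i'\<^esub> X\<^sub>i\<^sub>i\<close>. Its values at
  \<open>M = Q\<^sub>r\<^sup>-\<^sup>1 P\<^sub>\<gamma> Q\<^sub>r\<close> are found recursively from the entry \<open>(j', i')\<close> of
  \<open>Q\<^sub>r M = P\<^sub>\<gamma> Q\<^sub>r\<close>, multiplied by \<open>(P\<^sub>\<gamma>)\<^sub>i\<^sub>i\<close>; this recursion is the asserted relation.\<close>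

section \<open>Scalars in free algebras\<close>

text \<open>The scalar of \<open>psi (rootE i j)\<close> is never computed: only its
  \<open>N\<close>-th power enters, and there all powers of \<open>q\<close> and \<open>q_1\<close>
  become 1. Each simple root vector contributes a factor \<open>1 / lam\<close>, where
  \<open>lam = q_1 - 1/q_1\<close>, and each commutator gives one \<open>lam\<close> back, so a
  single \<open>1 / lam\<close> is left. Beyond the index \<theta>+1 each step also changes the
  sign, because there the commutator comes from the \<open>J\<close> part of the R-matrix. Together
  with the rescaling in the Frobenius map this gives \<open>root_scale\<close>, the origin of the
  constants \<open>2 (-1)^(\<theta>+1-j) (1+q_1)^(-N)\<close> and \<open>(-1)^(s-j)\<close> in the
  long relations.

  The element \<open>r_\<alpha>(\<mu>)\<close> is specified only by its values at all characters of
  \<open>T\<close>. For this reason an explicit polynomial in the \<open>g_k^N\<close> is defined by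
  the same recursion as these values. It satisfies the specification, hence yields a defining
  relator, and its recursion passes to the pointed Hopf algebra. All equalities are derived from
  relators; no basis of a presented algebra is used.\<close>

lemma scal_0 [simp]: "scal 0 = 0"
  by (simp add: scal_def)

lemma scal_1 [simp]: "scal 1 = 1"
  by (simp add: scal_def)

lemma scal_add: "scal (a + b) = scal a + scal b"
  by (simp add: scal_def single_add)

lemma scal_mult: "scal (a * b) = scal a * scal b"
  by (simp add: scal_def mult_single)

lemma scal_minus: "scal (- a) = - scal a"
  by (simp add: scal_def single_uminus)

lemma scal_diff: "scal (a - b) = scal a - scal b"
  by (simp add: scal_def single_diff)

text \<open>Updating a coefficient at a fresh word is adding a monomial, so a statement compatible
  with sums need only be checked on monomials.\<close>

lemma falg_induct [case_names single add]:
  fixes a :: "'g falg"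
  assumes "\<And>w c. P (Poly_Mapping.single w c)"
    and "\<And>a b. P a \<Longrightarrow> P b \<Longrightarrow> P (a + b)"
  shows "P a"
proof (induction a rule: update_induct)
  case const
  show ?case using assms(1)[of 0 0] by simp
next
  case (update a w c)
  have "Poly_Mapping.update w c a = a + Poly_Mapping.single w c"
    using update.hyps(1)
    by (intro poly_mapping_eqI) (auto simp: lookup_update lookup_add lookup_single in_keys_iff)
  then show ?case using update.IH assms by simp
qed

lemma scal_commute: "a * scal c = scal c * a"
  by (induction a rule: falg_induct)
    (simp_all add: scal_def mult_single distrib_left distrib_right mult.commute)

lemma scal_left_commute: "a * (scal c * b) = scal c * (a * b)"
  by (metis mult.assoc scal_commute)

lemma scal_mult_power: "(scal c * a) ^ n = scal (c ^ n) * a ^ n"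
  by (induction n) (simp_all add: scal_mult mult.assoc scal_left_commute[of a])

section \<open>Substitution homomorphisms\<close>

text \<open>\<open>subst\<close> sums over the support of its argument; a common superset makes the
  sums for \<open>a\<close>, \<open>b\<close> and \<open>a + b\<close> comparable.\<close>

lemma subst_superset:
  assumes "\<eta> 0 = 0" "finite W" "Poly_Mapping.keys a \<subseteq> W"
  shows "subst \<eta> f a = (\<Sum>w\<in>W. \<eta> (Poly_Mapping.lookup a w) * prod_list (map f (letters w)))"
  unfolding subst_def using assms
  by (intro sum.mono_neutral_left) (auto simp: in_keys_iff)

text \<open>Covers both uses of \<open>subst\<close>: homomorphisms into another free algebra and
  evaluation at complex points. Centrality of the scalars is what makes \<open>subst\<close>
  multiplicative.\<close>

locale scalar_embedding =
  fixes \<eta> :: "complex \<Rightarrow> 'r::ring_1"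
  assumes add: "\<eta> (a + b) = \<eta> a + \<eta> b"
    and mult: "\<eta> (a * b) = \<eta> a * \<eta> b"
    and one: "\<eta> 1 = 1"
    and central: "r * \<eta> a = \<eta> a * r"
begin

lemma zero: "\<eta> 0 = 0"
  using add[of 0 0] by simp

lemma subst_add: "subst \<eta> f (a + b) = subst \<eta> f a + subst \<eta> f b"
proof -
  let ?W = "Poly_Mapping.keys a \<union> Poly_Mapping.keys b"
  show ?thesis
    using subst_superset[where \<eta> = \<eta>, OF zero, of ?W, of "a + b" f] subst_superset[where \<eta> = \<eta>, OF zero, of ?W, of a f]
      subst_superset[where \<eta> = \<eta>, OF zero, of ?W, of b f] Poly_Mapping.keys_add[of a b]
    by (simp add: lookup_add add distrib_right sum.distrib)
qed

lemma subst_single: "subst \<eta> f (Poly_Mapping.single w c) = \<eta> c * prod_list (map f (letters w))"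
  by (subst subst_superset[of \<eta> "{w}"]) (auto simp: zero)

lemma subst_0: "subst \<eta> f 0 = 0"
  by (simp add: subst_def)

lemma subst_scal: "subst \<eta> f (scal c) = \<eta> c"
  by (simp add: scal_def subst_single zero_word_def)

lemma subst_1: "subst \<eta> f 1 = 1"
  using subst_scal[of f 1] by (simp add: one)

lemma subst_gen: "subst \<eta> f (gen x) = f x"
  by (simp add: gen_def subst_single one)

lemma subst_mult: "subst \<eta> f (a * b) = subst \<eta> f a * subst \<eta> f b"
proof (induction a rule: falg_induct)
  case (single v c)
  show ?case
  proof (induction b rule: falg_induct)
    case (single w d)
    show ?case
      by (simp add: mult_single subst_single mult plus_word_def mult.assoc)
        (metis central mult.assoc)
  qed (simp add: distrib_left subst_add)
qed (simp add: distrib_right subst_add)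

lemma subst_minus: "subst \<eta> f (- a) = - subst \<eta> f a"
  using subst_add[of f a "- a"] by (simp add: subst_0 eq_neg_iff_add_eq_0 add.commute)

lemma subst_diff: "subst \<eta> f (a - b) = subst \<eta> f a - subst \<eta> f b"
  using subst_add[of f a "- b"] by (simp add: subst_minus)

lemma subst_power: "subst \<eta> f (a ^ n) = subst \<eta> f a ^ n"
  by (induction n) (simp_all add: subst_1 subst_mult)

lemma subst_sum: "subst \<eta> f (sum g A) = (\<Sum>x\<in>A. subst \<eta> f (g x))"
  by (induction A rule: infinite_finite_induct) (simp_all add: subst_0 subst_add)

lemma subst_prod_list: "subst \<eta> f (prod_list as) = prod_list (map (subst \<eta> f) as)"
  by (induction as) (simp_all add: subst_1 subst_mult)

lemmas subst_simps = subst_0 subst_1 subst_scal subst_gen subst_add subst_minus subst_diff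
  subst_mult subst_power subst_sum subst_prod_list

end

interpretation hom_ext: scalar_embedding scal
  by standard (auto simp: scal_add scal_mult intro: scal_commute)

interpretation eval_at: scalar_embedding "\<lambda>c::complex. c"
  by standard simp_all

section \<open>Congruence modulo a two-sided ideal\<close>

lemma falg_on_0: "0 \<in> falg_on S"
  and falg_on_1: "1 \<in> falg_on S"
  and falg_on_scal: "scal c \<in> falg_on S"
  and falg_on_gen: "x \<in> S \<Longrightarrow> gen x \<in> falg_on S"
  by (auto simp: falg_on_def scal_def gen_def zero_word_def
      split: if_splits simp flip: single_one)

lemma falg_on_add: "a \<in> falg_on S \<Longrightarrow> b \<in> falg_on S \<Longrightarrow> a + b \<in> falg_on S"
  using Poly_Mapping.keys_add[of a b] by (auto simp: falg_on_def)

lemma falg_on_minus: "a \<in> falg_on S \<Longrightarrow> - a \<in> falg_on S"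
  by (simp add: falg_on_def)

lemma falg_on_diff: "a \<in> falg_on S \<Longrightarrow> b \<in> falg_on S \<Longrightarrow> a - b \<in> falg_on S"
  using falg_on_add[of a S "- b"] falg_on_minus[of b S] by simp

lemma falg_on_mult: "a \<in> falg_on S \<Longrightarrow> b \<in> falg_on S \<Longrightarrow> a * b \<in> falg_on S"
  using keys_mult[of a b] by (fastforce simp: falg_on_def plus_word_def)

lemma falg_on_power: "a \<in> falg_on S \<Longrightarrow> a ^ n \<in> falg_on S"
  by (induction n) (simp_all add: falg_on_1 falg_on_mult)

lemma falg_on_sum: "(\<And>x. x \<in> A \<Longrightarrow> f x \<in> falg_on S) \<Longrightarrow> sum f A \<in> falg_on S"
  by (induction A rule: infinite_finite_induct) (simp_all add: falg_on_0 falg_on_add)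

lemma falg_on_prod_list: "set as \<subseteq> falg_on S \<Longrightarrow> prod_list as \<in> falg_on S"
  by (induction as) (simp_all add: falg_on_1 falg_on_mult)

lemmas falg_on_intros = falg_on_0 falg_on_1 falg_on_scal falg_on_gen falg_on_add falg_on_minus
  falg_on_diff falg_on_mult falg_on_power falg_on_sum falg_on_prod_list

lemma alg_ideal_lmult:
  assumes "c \<in> falg_on S" "a \<in> alg_ideal S R"
  shows "c * a \<in> alg_ideal S R"
  using assms(2)
proof induction
  case (gen r a b)
  then have "(c * a) * r * b \<in> alg_ideal S R"
    using assms(1) by (intro alg_ideal.gen falg_on_mult)
  then show ?case by (simp add: mult.assoc)
qed (simp_all add: distrib_left alg_ideal.zero alg_ideal.add)

lemma alg_ideal_rmult:
  assumes "c \<in> falg_on S" "a \<in> alg_ideal S R"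
  shows "a * c \<in> alg_ideal S R"
  using assms(2)
proof induction
  case (gen r a b)
  then have "a * r * (b * c) \<in> alg_ideal S R"
    using assms(1) by (intro alg_ideal.gen falg_on_mult)
  then show ?case by (simp add: mult.assoc)
qed (simp_all add: distrib_right alg_ideal.zero alg_ideal.add)

lemma alg_ideal_minus: "a \<in> alg_ideal S R \<Longrightarrow> - a \<in> alg_ideal S R"
  using alg_ideal_lmult[of "- 1" S a R] by (simp add: falg_on_minus falg_on_1)

lemma alg_ideal_relator: "r \<in> R \<Longrightarrow> r \<in> alg_ideal S R"
  using alg_ideal.gen[of r R 1 S 1] by (simp add: falg_on_1)

text \<open>Restricting the congruence to \<^term>\<open>falg_on S\<close> makes it compatible with multiplication
  without side conditions.\<close>

definition alg_cong :: "'g set \<Rightarrow> 'g falg set \<Rightarrow> 'g falg \<Rightarrow> 'g falg \<Rightarrow> bool" where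
  "alg_cong S R a b \<longleftrightarrow> a \<in> falg_on S \<and> b \<in> falg_on S \<and> a - b \<in> alg_ideal S R"

lemma alg_congI:
  "a - b \<in> alg_ideal S R \<Longrightarrow> a \<in> falg_on S \<Longrightarrow> b \<in> falg_on S \<Longrightarrow> alg_cong S R a b"
  by (simp add: alg_cong_def)

lemma alg_cong_refl: "a \<in> falg_on S \<Longrightarrow> alg_cong S R a a"
  by (simp add: alg_cong_def alg_ideal.zero)

lemma alg_cong_sym: "alg_cong S R a b \<Longrightarrow> alg_cong S R b a"
  using alg_ideal_minus[of "a - b" S R] by (simp add: alg_cong_def)

lemma alg_cong_trans [trans]: "alg_cong S R a b \<Longrightarrow> alg_cong S R b c \<Longrightarrow> alg_cong S R a c"
  using alg_ideal.add[of "a - b" S R "b - c"] by (simp add: alg_cong_def)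

lemma alg_cong_add: "alg_cong S R a b \<Longrightarrow> alg_cong S R c d \<Longrightarrow> alg_cong S R (a + c) (b + d)"
  using alg_ideal.add[of "a - b" S R "c - d"] by (simp add: alg_cong_def falg_on_add algebra_simps)

lemma alg_cong_minus: "alg_cong S R a b \<Longrightarrow> alg_cong S R (- a) (- b)"
  using alg_ideal_minus[of "a - b" S R] by (simp add: alg_cong_def falg_on_minus)

lemma alg_cong_diff: "alg_cong S R a b \<Longrightarrow> alg_cong S R c d \<Longrightarrow> alg_cong S R (a - c) (b - d)"
  using alg_cong_add[of S R a b "- c" "- d"] alg_cong_minus[of S R c d] by simp

lemma alg_cong_mult:
  assumes "alg_cong S R a b" "alg_cong S R c d"
  shows "alg_cong S R (a * c) (b * d)"
proof -
  have "(a - b) * c + b * (c - d) \<in> alg_ideal S R"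
    using assms by (intro alg_ideal.add alg_ideal_lmult alg_ideal_rmult) (auto simp: alg_cong_def)
  then show ?thesis
    using assms by (simp add: alg_cong_def falg_on_mult algebra_simps)
qed

lemma alg_cong_lmult: "alg_cong S R a b \<Longrightarrow> c \<in> falg_on S \<Longrightarrow> alg_cong S R (c * a) (c * b)"
  by (intro alg_cong_mult alg_cong_refl)

lemma alg_cong_rmult: "alg_cong S R a b \<Longrightarrow> c \<in> falg_on S \<Longrightarrow> alg_cong S R (a * c) (b * c)"
  by (intro alg_cong_mult alg_cong_refl)

lemma alg_cong_power: "alg_cong S R a b \<Longrightarrow> alg_cong S R (a ^ n) (b ^ n)"
  by (induction n) (simp_all add: alg_cong_mult alg_cong_refl falg_on_1)

lemma alg_cong_sum:
  "(\<And>x. x \<in> A \<Longrightarrow> alg_cong S R (f x) (g x)) \<Longrightarrow> alg_cong S R (sum f A) (sum g A)"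
  by (induction A rule: infinite_finite_induct)
    (simp_all add: alg_cong_refl falg_on_0 alg_cong_add)

section \<open>Powers of elements that commute up to a scalar\<close>

lemma alg_cong_power_commute:
  assumes "alg_cong S R (x * y) (scal c * y * x)" "x \<in> falg_on S" "y \<in> falg_on S"
  shows "alg_cong S R (x ^ n * y) (scal (c ^ n) * y * x ^ n)"
proof (induction n)
  case (Suc n)
  have "alg_cong S R (x * (x ^ n * y)) (x * (scal (c ^ n) * y * x ^ n))"
    using Suc assms(2) by (rule alg_cong_lmult)
  also have "x * (scal (c ^ n) * y * x ^ n) = scal (c ^ n) * (x * y) * x ^ n"
    by (simp add: mult.assoc scal_left_commute[of x])
  also have "alg_cong S R \<dots> (scal (c ^ n) * (scal c * y * x) * x ^ n)"
    using assms by (intro alg_cong_rmult alg_cong_lmult falg_on_intros)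
  finally show ?case
    by (simp add: mult.assoc scal_mult) (metis mult.assoc scal_commute)
qed (simp add: alg_cong_refl assms)

text \<open>Appending one more factor \<open>y * x\<close> moves its \<open>y\<close> past
  \<open>x ^ n\<close>, at the cost of \<open>c ^ n\<close>; the exponents 0, 1, ..., n-1 add up to
  \<open>n (n-1) / 2\<close>.\<close>

lemma alg_cong_mult_power:
  assumes "alg_cong S R (x * y) (scal c * y * x)" "x \<in> falg_on S" "y \<in> falg_on S"
  shows "alg_cong S R ((y * x) ^ n) (scal (c ^ (n * (n - 1) div 2)) * y ^ n * x ^ n)"
proof (induction n)
  case (Suc n)
  let ?e = "n * (n - 1) div 2"
  have e: "Suc n * (Suc n - 1) div 2 = ?e + n"
    by (cases n) (auto simp: algebra_simps)
  have "alg_cong S R ((y * x) ^ n * (y * x)) (scal (c ^ ?e) * y ^ n * x ^ n * (y * x))"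
    using Suc assms by (intro alg_cong_rmult falg_on_intros)
  also have "scal (c ^ ?e) * y ^ n * x ^ n * (y * x) = scal (c ^ ?e) * y ^ n * (x ^ n * y) * x"
    by (simp add: mult.assoc)
  also have "alg_cong S R \<dots> (scal (c ^ ?e) * y ^ n * (scal (c ^ n) * y * x ^ n) * x)"
    using assms by (intro alg_cong_rmult alg_cong_lmult alg_cong_power_commute falg_on_intros)
  also have "\<dots> = scal (c ^ (?e + n)) * y ^ Suc n * x ^ Suc n"
    by (simp add: mult.assoc scal_mult power_add scal_left_commute[of "y ^ n"] power_Suc2
        del: power_Suc)
  finally show ?case unfolding e power_Suc2 by (simp add: mult.assoc)
qed (simp add: alg_cong_refl falg_on_1)

lemma alg_cong_prod_list_commute:
  assumes "a \<in> falg_on S" "\<And>b. b \<in> set bs \<Longrightarrow> alg_cong S R (b * a) (a * b)"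
    and "set bs \<subseteq> falg_on S"
  shows "alg_cong S R (prod_list bs * a) (a * prod_list bs)"
  using assms(2,3)
proof (induction bs)
  case (Cons b bs)
  have bs: "prod_list bs \<in> falg_on S" "b \<in> falg_on S"
    using Cons.prems(2) by (simp_all add: falg_on_prod_list)
  have "alg_cong S R (b * (prod_list bs * a)) (b * (a * prod_list bs))"
    using Cons bs by (intro alg_cong_lmult) simp_all
  also have "b * (a * prod_list bs) = (b * a) * prod_list bs"
    by (simp add: mult.assoc)
  also have "alg_cong S R \<dots> ((a * b) * prod_list bs)"
    using Cons.prems(1)[of b] bs by (intro alg_cong_rmult) simp_all
  finally show ?case by (simp add: mult.assoc)
qed (simp add: alg_cong_refl assms(1))

lemma alg_cong_prod_list_power:
  assumes "set as \<subseteq> falg_on S"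
    and "\<And>a b. a \<in> set as \<Longrightarrow> b \<in> set as \<Longrightarrow> alg_cong S R (a * b) (b * a)"
  shows "alg_cong S R (prod_list as ^ n) (prod_list (map (\<lambda>a. a ^ n) as))"
  using assms
proof (induction as)
  case (Cons a as)
  have as: "prod_list as \<in> falg_on S" "a \<in> falg_on S"
    using Cons.prems(1) by (simp_all add: falg_on_prod_list)
  have "alg_cong S R (prod_list as * a) (a * prod_list as)"
    using Cons.prems by (intro alg_cong_prod_list_commute) simp_all
  then have "alg_cong S R (prod_list as * a) (scal 1 * a * prod_list as)" by simp
  from alg_cong_mult_power[OF this as]
  have "alg_cong S R ((a * prod_list as) ^ n) (a ^ n * prod_list as ^ n)" by simp
  also have "alg_cong S R \<dots> (a ^ n * prod_list (map (\<lambda>a. a ^ n) as))"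
    using Cons.prems by (intro alg_cong_lmult Cons.IH falg_on_power) simp_all
  finally show ?case by simp
qed (simp add: alg_cong_refl falg_on_1)

lemma alg_cong_sum_zero:
  "(\<And>x. x \<in> A \<Longrightarrow> alg_cong S R (f x) 0) \<Longrightarrow> alg_cong S R (sum f A) 0"
  using alg_cong_sum[of A S R f "\<lambda>_. 0"] by simp

lemma alg_cong_sum_single:
  assumes "finite A" "x \<in> A" "alg_cong S R (f x) b"
    and "\<And>y. y \<in> A \<Longrightarrow> y \<noteq> x \<Longrightarrow> alg_cong S R (f y) 0"
  shows "alg_cong S R (sum f A) b"
proof -
  have "alg_cong S R (f x + sum f (A - {x})) (b + 0)"
    using assms by (intro alg_cong_add alg_cong_sum_zero) auto
  then show ?thesis using assms by (simp add: sum.remove)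
qed

lemma alg_cong_mult_zero:
  "alg_cong S R a 0 \<Longrightarrow> b \<in> falg_on S \<Longrightarrow> alg_cong S R (a * b) 0"
  "alg_cong S R a 0 \<Longrightarrow> b \<in> falg_on S \<Longrightarrow> alg_cong S R (b * a) 0"
  using alg_cong_rmult[of S R a 0 b] alg_cong_lmult[of S R a 0 b] by simp_all

text \<open>The common shape of all steps in the computation of the images of the root vectors:
  \<open>A D\<close> and \<open>B F\<close> are images of two root vectors, and \<open>W F\<close> that of their sum.\<close>

lemma alg_cong_skew_commutator:
  assumes mem: "A \<in> falg_on S" "B \<in> falg_on S" "D \<in> falg_on S" "D' \<in> falg_on S"
      "F \<in> falg_on S" "W \<in> falg_on S"
    and DB: "alg_cong S R (D * B) (scal d * B * D)"
    and FA: "alg_cong S R (F * A) (A * F)"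
    and FD: "alg_cong S R (F * D) (D * F)"
    and AB: "alg_cong S R (A * B) (scal u * B * A + scal v * W * D')"
    and D'D: "alg_cong S R (D' * D) 1"
    and t: "t = d * u"
  shows "alg_cong S R (A * D * (B * F) - scal t * (B * F) * (A * D)) (scal (d * v) * W * F)"
proof -
  have "alg_cong S R (A * (D * B) * F) (A * (scal d * B * D) * F)"
    using mem DB by (intro alg_cong_rmult alg_cong_lmult)
  also have "A * (scal d * B * D) * F = scal d * (A * B) * (D * F)"
    by (simp add: mult.assoc scal_left_commute[of A])
  also have "alg_cong S R \<dots> (scal d * (scal u * B * A + scal v * W * D') * (D * F))"
    using mem AB by (intro alg_cong_rmult alg_cong_lmult falg_on_intros)
  also have "\<dots> = scal t * B * A * D * F + scal (d * v) * W * (D' * D) * F"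
    by (simp add: t scal_mult distrib_left distrib_right mult.assoc)
  also have "alg_cong S R \<dots> (scal t * B * A * D * F + scal (d * v) * W * 1 * F)"
    using mem D'D
    by (intro alg_cong_add alg_cong_rmult alg_cong_lmult alg_cong_refl falg_on_intros)
  finally have 1: "alg_cong S R (A * D * (B * F)) (scal t * B * A * D * F + scal (d * v) * W * F)"
    by (simp add: mult.assoc)
  have "alg_cong S R (scal t * B * (F * A) * D) (scal t * B * (A * F) * D)"
    using mem FA by (intro alg_cong_rmult alg_cong_lmult falg_on_intros)
  also have "scal t * B * (A * F) * D = scal t * B * A * (F * D)"
    by (simp add: mult.assoc)
  also have "alg_cong S R \<dots> (scal t * B * A * (D * F))"
    using mem FD by (intro alg_cong_rmult alg_cong_lmult falg_on_intros)
  finally have 2: "alg_cong S R (scal t * (B * F) * (A * D)) (scal t * B * A * D * F)"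
    by (simp add: mult.assoc)
  show ?thesis using alg_cong_diff[OF 1 2] by simp
qed

lemma SUM_delta2:
  fixes f :: "nat \<Rightarrow> nat \<Rightarrow> 'a::semiring_0"
  assumes "finite A" "a \<in> A" "b \<in> A"
  shows "(\<Sum>k\<in>A. \<Sum>l\<in>A. (if l = a \<and> k = b then f k l else 0)) = f b a"
proof -
  have "(\<Sum>k\<in>A. \<Sum>l\<in>A. (if l = a \<and> k = b then f k l else 0)) =
      (\<Sum>k\<in>A. if k = b then f k a else 0)"
    using assms by (intro sum.cong refl) (auto simp: sum.delta')
  then show ?thesis using assms by simp
qed

section \<open>Relations in the quantized Borel subgroup\<close>

locale typeB_quantum =
  fixes \<theta> N :: nat and q :: complex
  assumes odd_N: "odd N" and q_N: "q ^ N = 1" and q_primitive: "\<And>m. 0 < m \<Longrightarrow> m < N \<Longrightarrow> q ^ m \<noteq> 1"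
    and N_gt: "N > 7"
begin

abbreviation p :: complex where "p \<equiv> q1 q"
definition lam :: complex where "lam = p - inverse p"

abbreviation n :: nat where "n \<equiv> nB \<theta>"
abbreviation pr :: "nat \<Rightarrow> nat" where "pr \<equiv> prm \<theta>"
abbreviation Z :: "nat \<Rightarrow> nat \<Rightarrow> (nat \<times> nat) falg" where "Z \<equiv> zg"

definition z_letters :: "(nat \<times> nat) set" where
  "z_letters = {1..n} \<times> {1..n}"

definition OqB_rels :: "(nat \<times> nat) falg set" where
  "OqB_rels = OqSO_rels \<theta> q \<union> {zg i j | i j. i \<in> {1..n} \<and> j \<in> {1..n} \<and> i > j}"

abbreviation OqB :: "(nat \<times> nat) falg set" where
  "OqB \<equiv> falg_on z_letters"

abbreviation OqB_cong :: "(nat \<times> nat) falg \<Rightarrow> (nat \<times> nat) falg \<Rightarrow> bool" (infix "\<approx>" 50) where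
  "OqB_cong \<equiv> alg_cong z_letters OqB_rels"

lemma OqB_ideal_eq: "OqB_ideal \<theta> q = alg_ideal z_letters OqB_rels"
  by (simp add: OqB_ideal_def z_letters_def OqB_rels_def)

lemma OqB_relator: "r \<in> OqB_rels \<Longrightarrow> a - b = r \<Longrightarrow> a \<in> OqB \<Longrightarrow> b \<in> OqB \<Longrightarrow> a \<approx> b"
  by (simp add: alg_congI alg_ideal_relator)

lemma zero_cong [simp]: "0 \<approx> 0"
  by (intro alg_cong_refl falg_on_0)

lemma q_nonzero: "q \<noteq> 0"
  using q_N N_gt by (auto simp: power_0_left split: if_splits)

lemma p_nonzero: "p \<noteq> 0"
  using q_nonzero by (simp add: q1_def)

lemma p_N: "p ^ N = 1"
  using q_N by (simp add: q1_def power_mult[symmetric] mult.commute[of 2]) (simp add: power_mult)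

text \<open>Here \<open>p\<^sup>2 = q ^ 4\<close> with \<open>4 < N\<close>. This makes
  \<open>lam\<close> and \<open>1 + p\<close> invertible.\<close>

lemma p2_neq_1: "p\<^sup>2 \<noteq> 1"
  using q_primitive[of 4] N_gt by (simp add: q1_def flip: power_mult)

lemma p_plus_1: "1 + p \<noteq> 0"
proof
  assume "1 + p = 0"
  then have "p = - 1" by (simp add: eq_neg_iff_add_eq_0 add.commute)
  then show False using p2_neq_1 by simp
qed

lemma lam_eq: "lam = (p\<^sup>2 - 1) / p"
  using p_nonzero by (simp add: lam_def field_simps power2_eq_square)

lemma lam_nonzero: "lam \<noteq> 0"
  using p2_neq_1 p_nonzero by (simp add: lam_eq)

lemma pr_in: "i \<in> {1..n} \<Longrightarrow> pr i \<in> {1..n}"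
  by (auto simp: prm_def nB_def)

lemma pr_pr: "i \<in> {1..n} \<Longrightarrow> pr (pr i) = i"
  by (auto simp: prm_def nB_def)

lemma Z_in: "i \<in> {1..n} \<Longrightarrow> j \<in> {1..n} \<Longrightarrow> Z i j \<in> OqB"
  unfolding zg_def by (intro falg_on_gen) (simp add: z_letters_def)

lemmas OqB_intros = falg_on_intros Z_in

lemma Z_lower:
  assumes "i \<in> {1..n}" "j \<in> {1..n}" "j < i"
  shows "Z i j \<approx> 0"
proof (rule OqB_relator)
  show "Z i j \<in> OqB_rels"
    unfolding OqB_rels_def by (rule UnI2) (use assms in blast)
qed (use assms in \<open>auto intro!: OqB_intros\<close>)

text \<open>The diagonal part and the flip part are written as conditionals so that the double sums
  in the defining relations collapse by \<open>SUM_delta2\<close>; only the \<open>J\<close> part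
  stays a sum.\<close>

lemma Rmat_eq: "Rmat \<theta> q i j a b =
    (if i = a \<and> j = b then p powi (of_bool (i = j) - of_bool (i = pr j)) else 0)
    + (if i = b \<and> j = a then of_bool (i > a) * lam else 0)
    - of_bool (i > a) * lam * cJ \<theta> q j i * cJ \<theta> q a b"
proof -
  have "x * of_bool A * of_bool B + c * y * (of_bool D * of_bool E - u * v) =
      (if A \<and> B then x else 0) + (if E \<and> D then c * y else 0) - c * y * u * v"
    for x c y u v :: complex and A B D E
    by (auto simp: algebra_simps)
  then show ?thesis unfolding Rmat_def lam_def .
qed

lemma RTT:
  assumes "i \<in> {1..n}" "j \<in> {1..n}" "a \<in> {1..n}" "b \<in> {1..n}"
  shows "scal (p powi (of_bool (a = b) - of_bool (a = pr b))) * (Z i b * Z j a)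
      + scal (of_bool (b > a) * lam) * (Z i a * Z j b)
      - (\<Sum>k\<in>{1..n}. \<Sum>l\<in>{1..n}.
          scal (of_bool (l > a) * lam * cJ \<theta> q k l * cJ \<theta> q a b) * (Z i k * Z j l))
    \<approx> scal (p powi (of_bool (j = i) - of_bool (j = pr i))) * (Z j a * Z i b)
      + scal (of_bool (j > i) * lam) * (Z i a * Z j b)
      - (\<Sum>k\<in>{1..n}. \<Sum>l\<in>{1..n}.
          scal (of_bool (j > k) * lam * cJ \<theta> q i j * cJ \<theta> q k l) * (Z k a * Z l b))"
  (is "?L \<approx> ?R")
proof (rule OqB_relator)
  let ?s = "\<lambda>T. \<Sum>k\<in>{1..n}. \<Sum>l\<in>{1..n}. (T k l :: (nat \<times> nat) falg)"
  let ?d = "\<lambda>a b x k l. if l = a \<and> k = b then x else 0 :: (nat \<times> nat) falg"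
  have eq: "scal ((if A then x else 0) + (if B then y else 0) - w) * (t::(nat \<times> nat) falg) =
      (if A then scal x * t else 0) + (if B then scal y * t else 0) - scal w * t" for A B x y w t
    by (auto simp: scal_add scal_diff distrib_right left_diff_distrib)
  have eqL: "scal (Rmat \<theta> q l k a b) * Z i k * Z j l =
      ?d a b (scal (p powi (of_bool (a = b) - of_bool (a = pr b))) * (Z i b * Z j a)) k l
      + ?d b a (scal (of_bool (b > a) * lam) * (Z i a * Z j b)) k l
      - scal (of_bool (l > a) * lam * cJ \<theta> q k l * cJ \<theta> q a b) * (Z i k * Z j l)" for k l
    unfolding mult.assoc[of "scal _"] unfolding Rmat_eq eq
    by (intro arg_cong2[where f = "(-)"] arg_cong2[where f = "(+)"] if_cong refl)
      ((elim conjE, simp only: ) | blast)+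
  have eqR: "scal (Rmat \<theta> q j i k l) * Z k a * Z l b =
      ?d i j (scal (p powi (of_bool (j = i) - of_bool (j = pr i))) * (Z j a * Z i b)) k l
      + ?d j i (scal (of_bool (j > i) * lam) * (Z i a * Z j b)) k l
      - scal (of_bool (j > k) * lam * cJ \<theta> q i j * cJ \<theta> q k l) * (Z k a * Z l b)" for k l
    unfolding mult.assoc[of "scal _"] unfolding Rmat_eq eq
    by (intro arg_cong2[where f = "(-)"] arg_cong2[where f = "(+)"] if_cong refl)
      ((elim conjE, simp only: ) | blast)+
  have "?s (\<lambda>k l. scal (Rmat \<theta> q l k a b) * Z i k * Z j l - scal (Rmat \<theta> q j i k l) * Z k a * Z l b)
      = ?L - ?R"
    unfolding sum_subtractf eqL eqR sum.distrib
    using assms by (simp only: SUM_delta2[of "{1..n}"] finite_atLeastAtMost)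
  then show "?L - ?R = ?s (\<lambda>k l. scal (Rmat \<theta> q l k a b) * Z i k * Z j l - scal (Rmat \<theta> q j i k l) * Z k a * Z l b)" ..
  show "?s (\<lambda>k l. scal (Rmat \<theta> q l k a b) * Z i k * Z j l - scal (Rmat \<theta> q j i k l) * Z k a * Z l b)
      \<in> OqB_rels"
    unfolding OqB_rels_def OqSO_rels_def
    by (intro UnI1, rule CollectI, use assms in blast)
  show "?L \<in> OqB" "?R \<in> OqB"
    using assms by (intro OqB_intros; simp)+
qed

section \<open>Commutation relations between matrix entries in the Borel quotient\<close>

lemma double_sum_zero:
  "(\<And>k l. k \<in> {1..n} \<Longrightarrow> l \<in> {1..n} \<Longrightarrow> T k l \<approx> 0)
    \<Longrightarrow> (\<Sum>k\<in>{1..n}. \<Sum>l\<in>{1..n}. T k l) \<approx> 0"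
  by (intro alg_cong_sum_zero)

text \<open>Since \<open>b\<close> is smaller than both \<open>j\<close> and \<open>a\<close>, each
  term of the two \<open>J\<close> sums with nonzero coefficient contains an entry below the
  diagonal, and so does the flip term \<open>Z b a * Z j b\<close>. Only the diagonal coefficients
  of \<open>R\<close> remain.\<close>

lemma diag_commute:
  assumes "1 \<le> b" "b < j" "j \<le> n" "b < a" "a \<le> n"
  shows "Z b b * Z j a \<approx> scal (p powi (of_bool (a = pr b) - of_bool (j = pr b))) * Z j a * Z b b"
proof -
  have mem: "b \<in> {1..n}" "j \<in> {1..n}" "a \<in> {1..n}" using assms by auto
  have s1: "(\<Sum>k\<in>{1..n}. \<Sum>l\<in>{1..n}.
      scal (of_bool (l > a) * lam * cJ \<theta> q k l * cJ \<theta> q a b) * (Z b k * Z j l)) \<approx> 0"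
  proof (rule double_sum_zero)
    fix k l assume kl: "k \<in> {1..n}" "l \<in> {1..n}"
    show "scal (of_bool (l > a) * lam * cJ \<theta> q k l * cJ \<theta> q a b) * (Z b k * Z j l) \<approx> 0"
    proof (cases "l > a \<and> k = pr l \<and> a = pr b")
      case True
      \<comment> \<open>Reflection reverses the order: \<open>l > a\<close> gives
        \<open>k = pr l < pr a = b\<close>.\<close>
      then have "k < b" using kl mem by (auto simp: prm_def nB_def)
      then show ?thesis
        using kl mem by (intro alg_cong_mult_zero Z_lower OqB_intros)
    next
      case False
      then show ?thesis by (auto simp: cJ_def)
    qed
  qed
  have s2: "(\<Sum>k\<in>{1..n}. \<Sum>l\<in>{1..n}.
      scal (of_bool (j > k) * lam * cJ \<theta> q b j * cJ \<theta> q k l) * (Z k a * Z l b)) \<approx> 0"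
  proof (rule double_sum_zero)
    fix k l assume kl: "k \<in> {1..n}" "l \<in> {1..n}"
    show "scal (of_bool (j > k) * lam * cJ \<theta> q b j * cJ \<theta> q k l) * (Z k a * Z l b) \<approx> 0"
    proof (cases "j > k \<and> b = pr j \<and> k = pr l")
      case True
      then have "b < l" using kl mem by (auto simp: prm_def nB_def)
      then show ?thesis
        using kl mem by (intro alg_cong_mult_zero Z_lower OqB_intros)
    next
      case False
      then show ?thesis by (auto simp: cJ_def)
    qed
  qed
  let ?u = "p powi (- of_bool (a = pr b))" and ?v = "p powi (- of_bool (j = pr b))"
  have "scal ?u * (Z b b * Z j a) - 0
      \<approx> scal ?u * (Z b b * Z j a)
      - (\<Sum>k\<in>{1..n}. \<Sum>l\<in>{1..n}.
          scal (of_bool (l > a) * lam * cJ \<theta> q k l * cJ \<theta> q a b) * (Z b k * Z j l))"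
    using mem by (intro alg_cong_diff alg_cong_sym[OF s1] alg_cong_refl OqB_intros)
  also have "\<dots> \<approx> scal ?v * (Z j a * Z b b) + scal lam * (Z b a * Z j b)
      - (\<Sum>k\<in>{1..n}. \<Sum>l\<in>{1..n}.
          scal (of_bool (j > k) * lam * cJ \<theta> q b j * cJ \<theta> q k l) * (Z k a * Z l b))"
    using RTT[OF mem(1,2,3,1)] assms by simp
  also have "\<dots> \<approx> scal ?v * (Z j a * Z b b) + 0 - 0"
    using mem assms
    by (intro alg_cong_diff alg_cong_add s2 alg_cong_mult_zero Z_lower alg_cong_refl OqB_intros)
  finally have "scal ?u * (Z b b * Z j a) \<approx> scal ?v * (Z j a * Z b b)" by simp
  then have "scal (inverse ?u) * (scal ?u * (Z b b * Z j a)) \<approx> scal (inverse ?u) * (scal ?v * (Z j a * Z b b))"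
    by (rule alg_cong_lmult) (rule falg_on_scal)
  then show ?thesis
    using p_nonzero by (simp add: mult.assoc[symmetric] power_int_diff power_int_minus
        divide_inverse flip: scal_mult)
qed

text \<open>For rows and columns that are not mirror images of each other the \<open>J\<close> part
  of \<open>R\<close> contributes nothing, and the relation has the form known from type A.\<close>

lemma Z_commutator:
  assumes "1 \<le> i" "i < j" "j \<le> n" "1 \<le> b" "b < a" "a \<le> n" "i \<noteq> pr j" "b \<noteq> pr a"
  shows "Z i b * Z j a \<approx> scal 1 * Z j a * Z i b + scal lam * Z i a * Z j b"
proof -
  have mem: "i \<in> {1..n}" "b \<in> {1..n}" "j \<in> {1..n}" "a \<in> {1..n}" using assms by auto
  have "a \<noteq> pr b" "j \<noteq> pr i" using assms mem pr_pr by metis+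
  then have "cJ \<theta> q a b = 0" "cJ \<theta> q i j = 0" using assms by (auto simp: cJ_def)
  then show ?thesis
    using RTT[OF mem(1,3,4,2)] assms \<open>a \<noteq> pr b\<close> \<open>j \<noteq> pr i\<close> by (simp add: mult.assoc)
qed

text \<open>Rows \<open>k'-1\<close> and \<open>k+1 = (k'-1)'\<close>: of the sum with the matrix \<open>J\<close> only one term survives.\<close>

lemma Z_skew_commutator:
  assumes "1 \<le> i" "i < k" "k \<le> \<theta>"
  shows "Z (pr k - 1) (pr k) * Z (k + 1) (pr i) \<approx>
      scal (if k = \<theta> then 1 else inverse p) * Z (k + 1) (pr i) * Z (pr k - 1) (pr k)
      + scal (- lam * (if k = \<theta> then inverse q else inverse p)) * Z k (pr i) * Z (pr k) (pr k)"
proof -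
  let ?i = "pr k - 1" and ?j = "k + 1" and ?a = "pr i" and ?b = "pr k"
  have mem: "?i \<in> {1..n}" "?j \<in> {1..n}" "?a \<in> {1..n}" "?b \<in> {1..n}" "k \<in> {1..n}"
    using assms by (auto simp: prm_def nB_def)
  have ne: "?a \<noteq> pr ?b" "?a \<noteq> ?b" "\<not> ?a < ?b" "?i = pr ?j" "\<not> ?i < ?j"
    using assms by (auto simp: prm_def nB_def)
  then have c0: "cJ \<theta> q ?a ?b = 0" by (simp add: cJ_def)
  \<comment> \<open>Consecutive \<open>\<rho>\<close> differ by 1, except that \<open>\<rho>\<close>
    is 1/2 at \<theta> and 0 at \<theta>+1. Thus \<open>q\<close> itself, the chosen square root of
    \<open>q_1\<close>, appears for \<open>k = \<theta>\<close>.\<close>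
  have r: "- two_rho \<theta> ?i - two_rho \<theta> k = (if k = \<theta> then -1 else -2)"
    using assms by (auto simp: two_rho_def prm_def nB_def)
  have c1: "of_bool (?j > k) * lam * cJ \<theta> q ?i ?j * cJ \<theta> q k ?b = lam * (if k = \<theta> then inverse q else inverse p)"
  proof -
    have "cJ \<theta> q ?i ?j * cJ \<theta> q k ?b = q powi (- two_rho \<theta> ?i - two_rho \<theta> k)"
      using ne pr_pr[OF mem(5)] q_nonzero by (simp add: cJ_def flip: power_int_add)
    then show ?thesis unfolding r by (simp add: q1_def power_int_minus mult.assoc power_int_def power_inverse)
  qed
  have s: "(\<Sum>k'\<in>{1..n}. \<Sum>l\<in>{1..n}.
      scal (of_bool (?j > k') * lam * cJ \<theta> q ?i ?j * cJ \<theta> q k' l) * (Z k' ?a * Z l ?b))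
      \<approx> scal (lam * (if k = \<theta> then inverse q else inverse p)) * (Z k ?a * Z ?b ?b)" (is "?S \<approx> _")
  proof (rule alg_cong_sum_single[of _ k])
    show "(\<Sum>l\<in>{1..n}.
        scal (of_bool (?j > k) * lam * cJ \<theta> q ?i ?j * cJ \<theta> q k l) * (Z k ?a * Z l ?b))
      \<approx> scal (lam * (if k = \<theta> then inverse q else inverse p)) * (Z k ?a * Z ?b ?b)"
    proof (rule alg_cong_sum_single[of _ ?b])
      show "scal (of_bool (?j > k) * lam * cJ \<theta> q ?i ?j * cJ \<theta> q k ?b) * (Z k ?a * Z ?b ?b)
        \<approx> scal (lam * (if k = \<theta> then inverse q else inverse p)) * (Z k ?a * Z ?b ?b)"
        unfolding c1 using mem by (intro alg_cong_refl OqB_intros)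
      fix l assume l: "l \<in> {1..n}" "l \<noteq> ?b"
      then have "k \<noteq> pr l" using pr_pr by metis
      then show "scal (of_bool (?j > k) * lam * cJ \<theta> q ?i ?j * cJ \<theta> q k l) * (Z k ?a * Z l ?b) \<approx> 0"
        by (simp add: cJ_def)
    qed (use mem in auto)
  next
    fix k' assume k': "k' \<in> {1..n}" "k' \<noteq> k"
    show "(\<Sum>l\<in>{1..n}.
        scal (of_bool (?j > k') * lam * cJ \<theta> q ?i ?j * cJ \<theta> q k' l) * (Z k' ?a * Z l ?b)) \<approx> 0"
    proof (rule alg_cong_sum_zero)
      fix l assume l: "l \<in> {1..n}"
      show "scal (of_bool (?j > k') * lam * cJ \<theta> q ?i ?j * cJ \<theta> q k' l) * (Z k' ?a * Z l ?b) \<approx> 0"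
      proof (cases "k' < ?j \<and> k' = pr l")
        case True
        \<comment> \<open>The coefficient forces \<open>k' < k + 1\<close>, and
          \<open>k' = k\<close> is excluded; the mirror image \<open>l\<close> of a row above
          \<open>k\<close> then exceeds \<open>pr k\<close>, so \<open>Z l ?b\<close> lies below the
          diagonal.\<close>
        then have "k' < k" "k' = pr l" using k' by simp_all
        then have "?b < l" using l by (auto simp: prm_def)
        then show ?thesis
          using k' l mem by (intro alg_cong_mult_zero Z_lower OqB_intros)
      next
        case False
        then show ?thesis by (auto simp: cJ_def)
      qed
    qed
  qed (use mem in auto)
  \<comment> \<open>For \<open>k = \<theta>\<close> both rows are the middle row \<theta>+1, its own
    mirror image, and the two indicators cancel.\<close>
  have e: "p powi (of_bool (?j = ?i) - of_bool (?j = pr ?i)) = (if k = \<theta> then 1 else inverse p)"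
    using assms by (auto simp: prm_def power_int_minus)
  have "Z ?i ?b * Z ?j ?a \<approx> scal (if k = \<theta> then 1 else inverse p) * (Z ?j ?a * Z ?i ?b) - ?S"
    using RTT[OF mem(1,2,3,4)] ne unfolding e c0 by simp
  also have "\<dots> \<approx> scal (if k = \<theta> then 1 else inverse p) * (Z ?j ?a * Z ?i ?b)
      - scal (lam * (if k = \<theta> then inverse q else inverse p)) * (Z k ?a * Z ?b ?b)"
    using mem by (intro alg_cong_diff s alg_cong_refl OqB_intros)
  finally show ?thesis by (simp add: mult.assoc scal_minus)
qed

text \<open>In the entry \<open>(i, i)\<close> of the first orthogonality relation a nonzero
  coefficient requires \<open>a = pr b\<close> and \<open>c = pr i\<close>. Unless
  \<open>a = i\<close>, one of the factors \<open>Z i a\<close>, \<open>Z c b\<close> is below the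
  diagonal. The surviving coefficient is 1 because \<open>\<rho>\<close> changes sign under
  reflection.\<close>

lemma Z_diag_inverse:
  assumes "i \<in> {1..n}"
  shows "Z i i * Z (pr i) (pr i) \<approx> 1"
proof -
  let ?t = "\<lambda>a b c. scal (cJ \<theta> q a b * cJ \<theta> q c i) * Z i a * Z c b"
  let ?S = "\<Sum>a\<in>{1..n}. \<Sum>b\<in>{1..n}. \<Sum>c\<in>{1..n}. ?t a b c"
  have mem: "pr i \<in> {1..n}" using pr_in assms .
  have ne: "two_rho \<theta> (pr i) = - two_rho \<theta> i"
    using assms by (auto simp: two_rho_def prm_def nB_def)
  have t0: "?t a b c \<approx> 0" if "a \<in> {1..n}" "b \<in> {1..n}" "c \<in> {1..n}" "a \<noteq> i \<or> b \<noteq> pr i \<or> c \<noteq> pr i" for a b c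
  proof (cases "a = pr b \<and> c = pr i")
    case True
    then have "a < i \<or> b < c" using that assms mem by (auto simp: prm_def nB_def)
    then show ?thesis
    proof
      assume "a < i"
      then show ?thesis using that assms by (intro alg_cong_mult_zero Z_lower OqB_intros)
    next
      assume "b < c"
      then show ?thesis using that assms by (intro alg_cong_mult_zero(2) Z_lower OqB_intros)
    qed
  qed (auto simp: cJ_def)
  have "?t i (pr i) (pr i) = Z i i * Z (pr i) (pr i)"
    using q_nonzero assms pr_pr[OF assms] by (simp add: cJ_def ne power_int_minus)
  then have t1: "?t i (pr i) (pr i) \<approx> Z i i * Z (pr i) (pr i)"
    using assms mem by (simp add: alg_cong_refl OqB_intros)
  have "?S \<approx> Z i i * Z (pr i) (pr i)"
    using assms mem
    by (intro alg_cong_sum_single[of _ i] alg_cong_sum_single[of _ "pr i"] alg_cong_sum_zero)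
      (auto intro: t1 t0)
  moreover have "?S \<approx> 1"
  proof (rule OqB_relator)
    show "?S - of_bool (i = i) \<in> OqB_rels"
      unfolding OqB_rels_def OqSO_rels_def
      by (rule UnI1, rule UnI1, rule UnI2, rule CollectI, use assms in blast)
    show "?S \<in> OqB" using assms by (intro OqB_intros)
  qed (simp_all add: falg_on_1)
  ultimately show ?thesis by (blast intro: alg_cong_sym alg_cong_trans)
qed

lemma diag_commute_plain:
  assumes "1 \<le> b" "b < j" "j \<le> n" "b < a" "a \<le> n" "a \<noteq> pr b" "j \<noteq> pr b"
  shows "Z b b * Z j a \<approx> Z j a * Z b b"
  using diag_commute[OF assms(1-5)] assms(6,7) by simp

subsection \<open>Root vectors\<close>

abbreviation psi :: "Ugen falg \<Rightarrow> (nat \<times> nat) falg" where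
  "psi \<equiv> hom_ext (psi_gen \<theta> q)"

text \<open>The power of \<open>q_1\<close> in the scalar is dropped: only the \<open>N\<close>-th
  power of the scalar is needed later.\<close>

lemma psi_E: "\<exists>e. (e * lam) ^ N = 1 \<and>
    psi (gen (E_gen k)) = scal e * (Z (pr k - 1) (pr k) * Z k k)"
proof (intro exI conjI)
  let ?e = "p ^ (2 - of_bool (k = \<theta>)) * inverse lam"
  show "(?e * lam) ^ N = 1"
    using lam_nonzero p_N by (simp add: mult.assoc flip: power_mult) (simp add: power_mult mult.commute[of _ N])
  show "psi (gen (E_gen k)) = scal ?e * (Z (pr k - 1) (pr k) * Z k k)"
    by (simp add: hom_ext.subst_gen lam_def mult.assoc)
qed

text \<open>Reduces one step of the root vector recursion to a skew commutator of matrix entries and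
  collects the scalars.\<close>

lemma psi_step:
  assumes X: "psi x \<approx> scal c * B * F"
    and "psi y = scal e * (A * D)"
    and mem: "A \<in> OqB" "B \<in> OqB" "D \<in> OqB" "F \<in> OqB"
    and step: "A * D * (B * F) - scal t * (B * F) * (A * D) \<approx> scal s * W * F"
  shows "psi (y * x - scal t * x * y) \<approx> scal (e * c * s) * W * F"
proof -
  have "psi (y * x - scal t * x * y)
      = scal e * (A * D) * psi x - scal t * psi x * (scal e * (A * D))"
    by (simp add: hom_ext.subst_simps assms(2))
  also have "\<dots> \<approx> scal e * (A * D) * (scal c * B * F) - scal t * (scal c * B * F) * (scal e * (A * D))"
    using mem X by (intro alg_cong_diff alg_cong_lmult alg_cong_rmult OqB_intros)
  also have "\<dots> = scal (e * c) * (A * D * (B * F) - scal t * (B * F) * (A * D))"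
  proof -
    have "scal t * (scal c * B * F) * (scal e * (A * D)) = scal e * (scal t * (scal c * (B * F)) * (A * D))"
      unfolding scal_left_commute[of "scal t * (scal c * B * F)"] by (simp only: mult.assoc)
    also have "scal t * (scal c * (B * F)) = scal c * (scal t * (B * F))"
      by (rule scal_left_commute)
    finally have "scal t * (scal c * B * F) * (scal e * (A * D)) = scal (e * c) * (scal t * (B * F) * (A * D))"
      by (simp only: mult.assoc scal_mult)
    moreover have "scal e * (A * D) * (scal c * B * F) = scal (e * c) * (A * D * (B * F))"
      by (simp only: mult.assoc scal_left_commute[of "A"] scal_left_commute[of "D"] scal_mult)
    ultimately show ?thesis by (simp add: right_diff_distrib)
  qed
  also have "\<dots> \<approx> scal (e * c) * (scal s * W * F)"
    using step by (rule alg_cong_lmult) (rule falg_on_scal)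
  finally show ?thesis by (simp add: scal_mult mult.assoc)
qed

text \<open>A step up to \<theta>+1 multiplies the scalar by \<open>e * lam / p\<close>, with
  \<open>N\<close>-th power 1. A later step multiplies it by \<open>- e * lam * w\<close>, with
  \<open>N\<close>-th power -1 since \<open>N\<close> is odd. The number of later steps is
  \<open>j - (\<theta>+1) = \<theta>+1 - pr j\<close>, which gives the sign.\<close>

lemma psi_rootE:
  assumes "1 \<le> i" "i < j" "j < pr i"
  shows "\<exists>c. c ^ N * (p\<^sup>2 - 1) ^ N = (if j \<le> \<theta> + 1 then 1 else (-1) ^ (\<theta> + 1 - pr j)) \<and>
    psi (rootE \<theta> q i j) \<approx> scal c * Z (pr j) (pr i) * Z i i"
proof -
  have "Suc i \<le> j" using assms by simp
  then show ?thesis using assms(3)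
  proof (induction j rule: dec_induct)
    case base
    obtain e where e: "(e * lam) ^ N = 1" "psi (gen (E_gen i)) = scal e * (Z (pr i - 1) (pr i) * Z i i)"
      using psi_E by blast
    have "(p\<^sup>2 - 1) ^ N = lam ^ N"
      using p_nonzero p_N by (simp add: lam_eq power_divide)
    moreover have "i \<le> \<theta>" "pr (Suc i) = pr i - 1" using base assms(1) by (auto simp: prm_def)
    moreover have "scal e * Z (pr i - 1) (pr i) * Z i i \<in> OqB"
      using base assms(1) by (intro OqB_intros) (auto simp: prm_def nB_def)
    ultimately show ?case
      using e by (intro exI[of _ e]) (simp add: power_mult_distrib alg_cong_refl mult.assoc)
  next
    case (step j)
    then obtain c where c: "c ^ N * (p\<^sup>2 - 1) ^ N = (if j \<le> \<theta> + 1 then 1 else (-1) ^ (\<theta> + 1 - pr j))"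
      "psi (rootE \<theta> q i j) \<approx> scal c * Z (pr j) (pr i) * Z i i" by auto
    have ij: "1 \<le> i" "i < j" "Suc j < pr i" using step assms(1) by auto
    have F: "Z i i \<in> OqB" using ij by (intro Z_in) (auto simp: prm_def nB_def)
    show ?case
    proof (cases "Suc j \<le> \<theta> + 1")
      case True
      obtain e where e: "(e * lam) ^ N = 1"
          "psi (gen (E_gen j)) = scal e * (Z (pr j - 1) (pr j) * Z j j)"
        using psi_E by blast
      have mem: "Z (pr j - 1) (pr j) \<in> OqB" "Z (pr j) (pr i) \<in> OqB" "Z j j \<in> OqB"
          "Z (pr j) (pr j) \<in> OqB" "Z (pr j - 1) (pr i) \<in> OqB" "pr j \<in> {1..n}" "j \<in> {1..n}"
        using ij True by (auto simp: prm_def nB_def intro!: Z_in)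
      have "Z (pr j - 1) (pr j) * Z j j * (Z (pr j) (pr i) * Z i i)
          - scal (inverse p) * (Z (pr j) (pr i) * Z i i) * (Z (pr j - 1) (pr j) * Z j j)
          \<approx> scal (inverse p * lam) * Z (pr j - 1) (pr i) * Z i i"
      proof (rule alg_cong_skew_commutator)
        have "pr i \<noteq> pr j" using ij True by (auto simp: prm_def)
        then show "Z j j * Z (pr j) (pr i) \<approx> scal (inverse p) * Z (pr j) (pr i) * Z j j"
          using diag_commute[of j "pr j" "pr i"] ij True by (auto simp: prm_def nB_def power_int_minus)
        show "Z i i * Z (pr j - 1) (pr j) \<approx> Z (pr j - 1) (pr j) * Z i i"
          by (rule diag_commute_plain) (use ij True in \<open>auto simp: prm_def nB_def\<close>)
        show "Z i i * Z j j \<approx> Z j j * Z i i"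
          by (rule diag_commute_plain) (use ij True in \<open>auto simp: prm_def nB_def\<close>)
        show "Z (pr j - 1) (pr j) * Z (pr j) (pr i) \<approx> scal 1 * Z (pr j) (pr i) * Z (pr j - 1) (pr j)
            + scal lam * Z (pr j - 1) (pr i) * Z (pr j) (pr j)"
          by (rule Z_commutator) (use ij True in \<open>auto simp: prm_def nB_def\<close>)
        show "Z (pr j) (pr j) * Z j j \<approx> 1"
          using Z_diag_inverse[OF mem(6)] pr_pr[OF mem(7)] by simp
      qed (use mem F in simp_all)
      from psi_step[OF c(2) e(2) mem(1,2,3) F this]
      have "psi (rootE \<theta> q i (Suc j)) \<approx> scal (e * c * (inverse p * lam)) * Z (pr (Suc j)) (pr i) * Z i i"
        using ij True by (simp add: rootE.simps(2)[of \<theta> q i j] prm_def del: rootE.simps)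
      moreover have "(e * c * (inverse p * lam)) ^ N * (p\<^sup>2 - 1) ^ N
          = (e * lam) ^ N * inverse (p ^ N) * (c ^ N * (p\<^sup>2 - 1) ^ N)"
        by (simp add: power_mult_distrib power_inverse mult_ac)
      then have "(e * c * (inverse p * lam)) ^ N * (p\<^sup>2 - 1) ^ N = 1"
        unfolding e(1) c(1) using True p_N by simp
      ultimately show ?thesis using True by (intro exI[of _ "e * c * (inverse p * lam)"]) simp
    next
      case False
      \<comment> \<open>The simple root \<open>\<alpha>_k\<close> already occurs once in the root of
        \<open>(i, j)\<close>; this step raises its multiplicity to 2.\<close>
      define k where "k = pr (Suc j)"
      have k: "i < k" "k \<le> \<theta>" "pr k = Suc j" "pr j = k + 1" "k = \<theta> \<longleftrightarrow> j = \<theta> + 1"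
        using ij False by (auto simp: k_def prm_def)
      define w where "w = (if k = \<theta> then inverse q else inverse p)"
      define u where "u = (if k = \<theta> then 1 else inverse p)"
      have u: "u = p powi (-1 + of_bool (Suc j = \<theta> + 2))"
        using k(5) by (simp add: u_def power_int_minus)
      have rec: "rootE \<theta> q i (Suc j) = gen (E_gen k) * rootE \<theta> q i j - scal u * rootE \<theta> q i j * gen (E_gen k)"
        using ij(2) False unfolding u k_def by (subst rootE.simps(2)) (simp del: rootE.simps)
      obtain e where e: "(e * lam) ^ N = 1"
          "psi (gen (E_gen k)) = scal e * (Z (pr k - 1) (pr k) * Z k k)"
        using psi_E by blast
      have mem: "Z (pr k - 1) (pr k) \<in> OqB" "Z (k + 1) (pr i) \<in> OqB" "Z k k \<in> OqB"
          "Z (pr k) (pr k) \<in> OqB" "Z k (pr i) \<in> OqB" "pr k \<in> {1..n}" "k \<in> {1..n}"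
        using ij k by (auto simp: prm_def nB_def intro!: Z_in)
      \<comment> \<open>In contrast to the previous case the diagonal entry \<open>Z k k\<close>
        commutes with \<open>Z (k + 1) (pr i)\<close>, and the scalar \<open>u\<close> of the
        recursion comes from exchanging the entries of the mirror rows \<open>pr k - 1\<close> and
        \<open>k + 1\<close>.\<close>
      have "Z (pr k - 1) (pr k) * Z k k * (Z (k + 1) (pr i) * Z i i)
          - scal u * (Z (k + 1) (pr i) * Z i i) * (Z (pr k - 1) (pr k) * Z k k)
          \<approx> scal (1 * (- lam * w)) * Z k (pr i) * Z i i"
      proof (rule alg_cong_skew_commutator)
        have "Z k k * Z (k + 1) (pr i) \<approx> Z (k + 1) (pr i) * Z k k"
          by (rule diag_commute_plain) (use ij k(1,2) in \<open>auto simp: prm_def nB_def\<close>)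
        then show "Z k k * Z (k + 1) (pr i) \<approx> scal 1 * Z (k + 1) (pr i) * Z k k" by simp
        show "Z i i * Z (pr k - 1) (pr k) \<approx> Z (pr k - 1) (pr k) * Z i i"
          by (rule diag_commute_plain) (use ij k(1,2) in \<open>auto simp: prm_def nB_def\<close>)
        show "Z i i * Z k k \<approx> Z k k * Z i i"
          by (rule diag_commute_plain) (use ij k(1,2) in \<open>auto simp: prm_def nB_def\<close>)
        show "Z (pr k - 1) (pr k) * Z (k + 1) (pr i) \<approx> scal u * Z (k + 1) (pr i) * Z (pr k - 1) (pr k)
            + scal (- lam * w) * Z k (pr i) * Z (pr k) (pr k)"
          using Z_skew_commutator[of i k] ij k unfolding u_def w_def by blast
        show "Z (pr k) (pr k) * Z k k \<approx> 1"
          using Z_diag_inverse[OF mem(6)] pr_pr[OF mem(7)] by simp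
      qed (use mem F in simp_all)
      from psi_step[OF c(2)[unfolded k(4)] e(2) mem(1,2,3) F this]
      have "psi (rootE \<theta> q i (Suc j)) \<approx> scal (e * c * (1 * (- lam * w))) * Z (pr (Suc j)) (pr i) * Z i i"
        unfolding rec k_def[symmetric] .
      moreover have "w ^ N = 1" using q_N p_N by (simp add: w_def power_inverse)
      have "(e * c * (1 * (- lam * w))) ^ N * (p\<^sup>2 - 1) ^ N
          = (e * lam) ^ N * (- (w ^ N)) * (c ^ N * (p\<^sup>2 - 1) ^ N)"
        using odd_N by (simp add: power_mult_distrib mult_ac)
      then have "(e * c * (1 * (- lam * w))) ^ N * (p\<^sup>2 - 1) ^ N = - (c ^ N * (p\<^sup>2 - 1) ^ N)"
        unfolding e(1) \<open>w ^ N = 1\<close> by simp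
      moreover have "- (c ^ N * (p\<^sup>2 - 1) ^ N) = (-1) ^ (\<theta> + 1 - k)"
        unfolding c(1) using k False by (auto simp: Suc_diff_le)
      ultimately show ?thesis
        using False by (intro exI[of _ "e * c * (1 * (- lam * w))"]) (simp add: k_def)
    qed
  qed
qed

text \<open>The \<open>N\<close>-th power of the scalar in \<open>psi_rootE\<close>, divided by the
  factor \<open>(1 + p) ^ N / 2\<close> wherever the Frobenius map puts it on the coordinate
  \<open>(pr j, pr i)\<close>.\<close>

definition root_scale :: "nat \<Rightarrow> complex" where
  "root_scale j = (if j \<le> \<theta> + 1 then 1 / (p\<^sup>2 - 1) ^ N
     else 2 * (-1) ^ (\<theta> + 1 - pr j) / ((1 + p) ^ N * (p\<^sup>2 - 1) ^ N))"

definition root_function :: "nat \<Rightarrow> nat \<Rightarrow> (nat \<times> nat) falg" where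
  "root_function i j = scal (root_scale j) * (gen (pr j, pr i) * gen (i, i))"

lemma frob_root_function:
  assumes "1 \<le> i" "i < j" "j < pr i"
  shows "hom_ext (frob_gen \<theta> N q) (root_function i j) - psi (rootE \<theta> q i j ^ N) \<in> OqB_ideal \<theta> q"
proof -
  obtain c where c: "c ^ N * (p\<^sup>2 - 1) ^ N = (if j \<le> \<theta> + 1 then 1 else (-1) ^ (\<theta> + 1 - pr j))"
    "psi (rootE \<theta> q i j) \<approx> scal c * Z (pr j) (pr i) * Z i i"
    using psi_rootE[OF assms] by blast
  have i: "i \<le> \<theta>" and mem: "i \<in> {1..n}" "Z i i \<in> OqB" "Z (pr j) (pr i) \<in> OqB"
    using assms by (auto simp: prm_def nB_def intro!: Z_in)
  have "Z i i * Z (pr j) (pr i) \<approx> scal (p powi (of_bool (pr i = pr i) - of_bool (pr j = pr i))) * Z (pr j) (pr i) * Z i i"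
    using assms i by (intro diag_commute) (auto simp: prm_def nB_def)
  moreover have "pr j \<noteq> pr i" using assms by (auto simp: prm_def)
  ultimately have "Z i i * Z (pr j) (pr i) \<approx> scal p * Z (pr j) (pr i) * Z i i" by simp
  from alg_cong_mult_power[OF this mem(2,3), of N]
  have "(Z (pr j) (pr i) * Z i i) ^ N \<approx> scal (p ^ (N * (N - 1) div 2)) * Z (pr j) (pr i) ^ N * Z i i ^ N" .
  \<comment> \<open>As \<open>N\<close> is odd, the exponent of \<open>p\<close> produced by
    reordering is a multiple of \<open>N\<close>, so this scalar is 1.\<close>
  moreover have "N * (N - 1) div 2 = N * ((N - 1) div 2)"
    using odd_N by (intro div_mult_swap[symmetric]) simp
  ultimately have pow: "(Z (pr j) (pr i) * Z i i) ^ N \<approx> Z (pr j) (pr i) ^ N * Z i i ^ N"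
    using p_N by (simp add: power_mult)
  have "psi (rootE \<theta> q i j ^ N) = psi (rootE \<theta> q i j) ^ N" by (rule hom_ext.subst_power)
  also have "\<dots> \<approx> (scal c * (Z (pr j) (pr i) * Z i i)) ^ N"
    using alg_cong_power[OF c(2), of N] by (simp add: mult.assoc)
  also have "\<dots> = scal (c ^ N) * (Z (pr j) (pr i) * Z i i) ^ N"
    by (rule scal_mult_power)
  also have "\<dots> \<approx> scal (c ^ N) * (Z (pr j) (pr i) ^ N * Z i i ^ N)"
    using pow by (rule alg_cong_lmult) (rule falg_on_scal)
  also have "\<dots> = hom_ext (frob_gen \<theta> N q) (root_function i j)"
  proof -
    let ?w = "if pr j < \<theta> + 1 \<and> \<theta> + 1 < pr i then (1 + p) ^ N / 2 else 1"
    have "c ^ N = root_scale j * ?w"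
    proof (cases "j \<le> \<theta> + 1")
      case True
      then have "\<not> pr j < \<theta> + 1" by (auto simp: prm_def)
      then show ?thesis using c(1) True p2_neq_1 by (simp add: root_scale_def field_simps)
    next
      case False
      then have "pr j < \<theta> + 1" "\<theta> + 1 < pr i" using assms i by (auto simp: prm_def)
      then show ?thesis using c(1) False p2_neq_1 p_plus_1 by (simp add: root_scale_def field_simps)
    qed
    moreover have "hom_ext (frob_gen \<theta> N q) (root_function i j)
        = scal (root_scale j) * (scal ?w * Z (pr j) (pr i) ^ N * Z i i ^ N)"
      using i by (simp add: root_function_def hom_ext.subst_simps frob_gen_def)
    ultimately show ?thesis by (simp only: scal_mult mult.assoc)
  qed
  finally have "hom_ext (frob_gen \<theta> N q) (root_function i j) \<approx> psi (rootE \<theta> q i j ^ N)"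
    by (rule alg_cong_sym)
  then show ?thesis by (simp add: alg_cong_def OqB_ideal_eq)
qed

end

section \<open>The relations in the pointed Hopf algebra\<close>

text \<open>Row \<open>r\<close> of \<open>Q M = P Q\<close> expresses row \<open>r\<close> of
  \<open>M\<close> through the rows below it. Descending induction on the row shows that
  \<open>M\<close> is upper triangular, so in column \<open>s\<close> the recursion ends at row
  \<open>s\<close>. No inverse of \<open>Q\<close> is needed.\<close>

lemma unitriangular_conjugate:
  fixes Q M :: "nat \<Rightarrow> nat \<Rightarrow> complex" and P :: "nat \<Rightarrow> complex"
  assumes low: "\<And>r s. r \<in> {1..n} \<Longrightarrow> s \<in> {1..n} \<Longrightarrow> s < r \<Longrightarrow> Q r s = 0"
    and diag: "\<And>r. r \<in> {1..n} \<Longrightarrow> Q r r = 1"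
    and QM: "\<And>r s. r \<in> {1..n} \<Longrightarrow> s \<in> {1..n} \<Longrightarrow> (\<Sum>k\<in>{1..n}. Q r k * M k s) = P r * Q r s"
    and rs: "r \<in> {1..n}" "s \<in> {1..n}"
  shows "M s s = P s"
    and "r < s \<Longrightarrow> M r s = (P r - P s) * Q r s - (\<Sum>k\<in>{r<..<s}. Q r k * M k s)"
proof -
  have rec: "M r s + (\<Sum>k\<in>{r<..n}. Q r k * M k s) = P r * Q r s"
    if "r \<in> {1..n}" "s \<in> {1..n}" for r s
  proof -
    have "(\<Sum>k\<in>{1..n}. Q r k * M k s) = (\<Sum>k\<in>{r..n}. Q r k * M k s)"
      using that by (intro sum.mono_neutral_right) (auto simp: low)
    also have "{r..n} = insert r {r<..n}" using that by auto
    finally show ?thesis using QM[OF that] diag that by simp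
  qed
  have zero: "s < r \<longrightarrow> M r s = 0" if "r \<in> {1..n}" "s \<in> {1..n}" for r s
    using that(1)
  proof (induction "n - r" arbitrary: r rule: less_induct)
    case less
    show ?case
    proof
      assume "s < r"
      then have "(\<Sum>k\<in>{r<..n}. Q r k * M k s) = 0"
        using less by (intro sum.neutral) auto
      then show "M r s = 0" using rec[of r s] low[of r s] less.prems that(2) \<open>s < r\<close> by simp
    qed
  qed
  have diagM: "M s s = P s"
  proof -
    have "(\<Sum>k\<in>{s<..n}. Q s k * M k s) = 0"
      using rs zero by (intro sum.neutral) auto
    then show ?thesis using rec[of s s] diag rs by simp
  qed
  then show "M s s = P s" .
  show "M r s = (P r - P s) * Q r s - (\<Sum>k\<in>{r<..<s}. Q r k * M k s)" if "r < s"
  proof -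
    have "(\<Sum>k\<in>{r<..n}. Q r k * M k s) = (\<Sum>k\<in>{r<..s}. Q r k * M k s)"
      using rs zero by (intro sum.mono_neutral_right) auto
    also have "{r<..s} = insert s {r<..<s}" using that by auto
    finally show ?thesis using rec[OF rs] diagM by (simp add: algebra_simps)
  qed
qed

locale typeB_lifting = typeB_quantum +
  fixes nn :: "nat \<Rightarrow> nat" and \<mu> :: "nat \<Rightarrow> nat \<Rightarrow> complex"
  assumes nn: "\<And>i. i \<in> {1..\<theta>} \<Longrightarrow> nn i > 0 \<and> N dvd nn i"
begin

section \<open>Values of the coordinate functions at the embedded characters\<close>

abbreviation r :: "nat \<Rightarrow> nat \<Rightarrow> complex" where "r \<equiv> r_entry \<theta> N q \<mu>"
abbreviation Tor :: "(nat \<Rightarrow> complex) \<Rightarrow> nat \<Rightarrow> complex" where "Tor \<equiv> torus_entry \<theta>"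

text \<open>The value is a root of unity whose exponent \<open>nn i div N\<close> is positive,
  because \<open>N\<close> divides \<open>nn i > 0\<close>.\<close>

lemma T_hat_nonzero: "\<gamma> \<in> T_hat \<theta> N nn \<Longrightarrow> i \<in> {1..\<theta>} \<Longrightarrow> \<gamma> i \<noteq> 0"
  using nn[of i] by (auto simp: T_hat_def power_0_left dvd_div_eq_0_iff dest!: bspec)

lemma Qr_facts:
  shows "Qr \<theta> N q \<mu> \<in> carrier_mat n n" "upper_triangular (Qr \<theta> N q \<mu>)" "det (Qr \<theta> N q \<mu>) = 1"
  using is_Qr_Qr[of \<theta> N q \<mu>] by (auto simp: is_Qr_def Bplus_def SO_def)

lemma r_diag: "i \<in> {1..n} \<Longrightarrow> r i i = 1"
  using is_Qr_Qr[of \<theta> N q \<mu>] by (simp add: is_Qr_def r_entry_def)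

lemma r_lower: "i \<in> {1..n} \<Longrightarrow> j \<in> {1..n} \<Longrightarrow> j < i \<Longrightarrow> r i j = 0"
  using Qr_facts(1,2) by (auto simp: r_entry_def entry_def upper_triangular_def)

lemma r_short:
  "1 \<le> i \<Longrightarrow> i < j \<Longrightarrow> j \<le> \<theta> + 1 \<Longrightarrow> r (pr j) (pr i) = (p\<^sup>2 - 1) ^ N * \<mu> i j"
  and r_long: "1 \<le> i \<Longrightarrow> i < j \<Longrightarrow> j \<le> \<theta> \<Longrightarrow> r j (pr i) =
    (-1) ^ (\<theta> + 1 - j) * (1 / 2) * (p\<^sup>2 - 1) ^ N * (p + 1) ^ N * \<mu> i (pr j)"
  using is_Qr_Qr[of \<theta> N q \<mu>] by (auto simp: is_Qr_def r_entry_def)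

text \<open>Multiplying by \<open>Q_r\<close> removes the inverse from the definition of
  \<open>iota_mu\<close>; that inverse exists because \<open>Q_r\<close> has determinant 1.\<close>

lemma iota_mu_intertwines:
  "Qr \<theta> N q \<mu> * iota_mu \<theta> N q \<mu> \<gamma> = P_mat \<theta> \<gamma> * Qr \<theta> N q \<mu>"
  and iota_mu_carrier: "iota_mu \<theta> N q \<mu> \<gamma> \<in> carrier_mat n n"
proof -
  let ?Q = "Qr \<theta> N q \<mu>" and ?P = "P_mat \<theta> \<gamma>"
  have P: "?P \<in> carrier_mat n n" by (simp add: P_mat_def)
  have "mat_inverse ?Q \<noteq> None"
    using mat_inverse(1)[OF Qr_facts(1), where b = "0 :: nat"]
      det_non_zero_imp_unit[OF Qr_facts(1), where b = "0 :: nat"] Qr_facts(3)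
    by auto
  then obtain B where B: "mat_inverse ?Q = Some B" by blast
  then have *: "?Q * B = 1\<^sub>m n" "B \<in> carrier_mat n n"
    using mat_inverse(2)[OF Qr_facts(1)] by auto
  have i: "iota_mu \<theta> N q \<mu> \<gamma> = B * ?P * ?Q" by (simp add: iota_mu_def B)
  then show "iota_mu \<theta> N q \<mu> \<gamma> \<in> carrier_mat n n" using * P Qr_facts(1) by simp
  have "?Q * (B * ?P * ?Q) = (?Q * B) * (?P * ?Q)"
    using *(2) P Qr_facts(1) by (simp add: assoc_mult_mat[of _ n n _ n _ n])
  then show "?Q * iota_mu \<theta> N q \<mu> \<gamma> = ?P * ?Q"
    using i * P Qr_facts(1) by simp
qed

lemma entry_mult:
  assumes "A \<in> carrier_mat n n" "B \<in> carrier_mat n n" "i \<in> {1..n}" "j \<in> {1..n}"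
  shows "entry (A * B) (i, j) = (\<Sum>k\<in>{1..n}. entry A (i, k) * entry B (k, j))"
proof -
  have "entry (A * B) (i, j) = (\<Sum>k<n. A $$ (i - 1, k) * B $$ (k, j - 1))"
    using assms by (auto simp: entry_def scalar_prod_def lessThan_atLeast0)
  also have "\<dots> = (\<Sum>k\<in>{1..n}. entry A (i, k) * entry B (k, j))"
    by (rule sum.reindex_bij_witness[of _ "\<lambda>k. k - 1" Suc]) (auto simp: entry_def)
  finally show ?thesis .
qed

lemma P_mat_mult_entry:
  assumes "i \<in> {1..n}" "j \<in> {1..n}"
  shows "entry (P_mat \<theta> \<gamma> * Qr \<theta> N q \<mu>) (i, j) = Tor \<gamma> i * r i j"
proof -
  have "entry (P_mat \<theta> \<gamma> * Qr \<theta> N q \<mu>) (i, j) =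
      (\<Sum>k\<in>{1..n}. entry (P_mat \<theta> \<gamma>) (i, k) * entry (Qr \<theta> N q \<mu>) (k, j))"
    using assms Qr_facts(1) by (intro entry_mult) (auto simp: P_mat_def)
  also have "\<dots> = (\<Sum>k\<in>{1..n}. if k = i then Tor \<gamma> i * r i j else 0)"
    using assms by (intro sum.cong) (auto simp: entry_def P_mat_def r_entry_def)
  finally show ?thesis using assms by simp
qed

lemma Tor_pr:
  assumes "\<gamma> \<in> T_hat \<theta> N nn" "1 \<le> i" "i \<le> \<theta>"
  shows "Tor \<gamma> (pr i) * Tor \<gamma> i = 1"
proof -
  have "(\<Prod>k\<in>{i..\<theta>}. \<gamma> k) \<noteq> 0" using T_hat_nonzero[OF assms(1)] assms by simp
  then show ?thesis using assms by (simp add: torus_entry_def prm_def)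
qed

definition root_value :: "(nat \<Rightarrow> complex) \<Rightarrow> nat \<Rightarrow> nat \<Rightarrow> complex" where
  "root_value \<gamma> i j = entry (iota_mu \<theta> N q \<mu> \<gamma>) (pr j, pr i) * entry (iota_mu \<theta> N q \<mu> \<gamma>) (i, i)"

lemma root_value_rec:
  assumes \<gamma>: "\<gamma> \<in> T_hat \<theta> N nn" and ij: "1 \<le> i" "i < j" "j < pr i"
  shows "root_value \<gamma> i j = r (pr j) (pr i) * (Tor \<gamma> (pr j) * Tor \<gamma> i - 1)
    - (\<Sum>s\<in>{i<..<j}. r (pr j) (pr s) * root_value \<gamma> i s)"
proof -
  let ?M = "\<lambda>a b. entry (iota_mu \<theta> N q \<mu> \<gamma>) (a, b)"
  have QM: "(\<Sum>k\<in>{1..n}. r a k * ?M k b) = Tor \<gamma> a * r a b" if "a \<in> {1..n}" "b \<in> {1..n}" for a b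
    using entry_mult[OF Qr_facts(1) iota_mu_carrier that, of \<gamma>] P_mat_mult_entry[OF that, of \<gamma>]
    by (simp add: iota_mu_intertwines r_entry_def)
  have mem: "i \<in> {1..n}" "pr i \<in> {1..n}" "pr j \<in> {1..n}" "i \<le> \<theta>" "pr j < pr i"
    using ij by (auto simp: prm_def nB_def)
  have M_above: "?M (pr j) (pr i) = (Tor \<gamma> (pr j) - Tor \<gamma> (pr i)) * r (pr j) (pr i)
      - (\<Sum>k\<in>{pr j<..<pr i}. r (pr j) k * ?M k (pr i))"
    by (rule unitriangular_conjugate(2)[OF r_lower r_diag QM mem(3,2,5)])
  have M_diag: "?M i i = Tor \<gamma> i"
    by (rule unitriangular_conjugate(1)[OF r_lower r_diag QM mem(1,1)])
  have "?M (pr j) (pr i) * Tor \<gamma> i = (Tor \<gamma> (pr j) - Tor \<gamma> (pr i)) * r (pr j) (pr i) * Tor \<gamma> i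
      - (\<Sum>k\<in>{pr j<..<pr i}. r (pr j) k * ?M k (pr i)) * Tor \<gamma> i"
    by (simp add: M_above left_diff_distrib)
  also have "(Tor \<gamma> (pr j) - Tor \<gamma> (pr i)) * r (pr j) (pr i) * Tor \<gamma> i
      = r (pr j) (pr i) * (Tor \<gamma> (pr j) * Tor \<gamma> i - Tor \<gamma> (pr i) * Tor \<gamma> i)"
    by (simp add: algebra_simps)
  \<comment> \<open>Mirror-image torus entries are inverse to each other; this is the source of the
    -1 in \<open>g^N - 1\<close>.\<close>
  also have "\<dots> = r (pr j) (pr i) * (Tor \<gamma> (pr j) * Tor \<gamma> i - 1)"
    using Tor_pr[OF \<gamma> ij(1) mem(4)] by simp
  also have "(\<Sum>k\<in>{pr j<..<pr i}. r (pr j) k * ?M k (pr i)) * Tor \<gamma> i =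
      (\<Sum>s\<in>{i<..<j}. r (pr j) (pr s) * (?M (pr s) (pr i) * Tor \<gamma> i))"
    unfolding sum_distrib_right
    by (rule sum.reindex_bij_witness[of _ pr pr]) (use ij in \<open>auto simp: prm_def\<close>)
  finally show ?thesis
    by (simp add: root_value_def M_diag)
qed

section \<open>Explicit elements of the group algebra of T\<close>

definition root_monomial :: "nat \<Rightarrow> nat \<Rightarrow> nat falg" where
  "root_monomial i j = (if j \<le> \<theta> + 1 then prod_list (map gen [i..<j])
     else prod_list (map gen [i..<pr j]) * prod_list (map (\<lambda>k. gen k ^ 2) [pr j..<\<theta> + 1]))"

text \<open>\<open>Tor \<gamma> i\<close> is the product of the values from \<open>i\<close> to
  \<theta>. The factor \<open>Tor \<gamma> (pr j)\<close> cancels its tail from \<open>j\<close> on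
  if \<open>j \<le> \<theta>+1\<close>, and otherwise doubles the tail from \<open>pr j\<close> on,
  matching the multiplicities of the root.\<close>

lemma eval_root_monomial:
  assumes \<gamma>: "\<gamma> \<in> T_hat \<theta> N nn" and ij: "1 \<le> i" "i < j" "j < pr i"
  shows "eval_at \<gamma> (root_monomial i j) = Tor \<gamma> (pr j) * Tor \<gamma> i"
proof -
  have pl: "prod_list (map f [a..<b]) = (\<Prod>k\<in>{a..<b}. f k)" for f :: "nat \<Rightarrow> complex" and a b
    by (simp add: prod.distinct_set_conv_list[symmetric])
  have i: "i \<le> \<theta>" using ij by (auto simp: prm_def)
  have split: "(\<Prod>k\<in>{i..\<theta>}. \<gamma> k) = (\<Prod>k\<in>{i..<m}. \<gamma> k) * (\<Prod>k\<in>{m..\<theta>}. \<gamma> k)" if "i \<le> m" "m \<le> \<theta> + 1" for m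
  proof -
    have "{i..\<theta>} = {i..<m} \<union> {m..\<theta>}" using that by auto
    moreover have "{i..<m} \<inter> {m..\<theta>} = {}" by auto
    ultimately show ?thesis by (simp add: prod.union_disjoint)
  qed
  show ?thesis
  proof (cases "j \<le> \<theta> + 1")
    case True
    have nz: "(\<Prod>k\<in>{j..\<theta>}. \<gamma> k) \<noteq> 0" using T_hat_nonzero[OF \<gamma>] ij by simp
    have "Tor \<gamma> (pr j) = inverse (\<Prod>k\<in>{j..\<theta>}. \<gamma> k)"
      using ij True by (auto simp: torus_entry_def prm_def)
    then show ?thesis
      using True ij i split[of j] nz
      by (simp add: root_monomial_def eval_at.subst_simps o_def pl) (simp add: torus_entry_def)
  next
    case False
    have "{pr j..<\<theta> + 1} = {pr j..\<theta>}" by auto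
    moreover have "pr j \<le> \<theta>" "i \<le> pr j" using False ij by (auto simp: prm_def)
    ultimately show ?thesis
      using False i split[of "pr j"]
      by (simp add: root_monomial_def eval_at.subst_simps o_def pl torus_entry_def
          power2_eq_square prod.distrib del: upt_Suc)
  qed
qed

text \<open>This is \<open>root_value_rec\<close> with characters replaced by group elements. It is
  normalized to represent \<open>root_scale j\<close> times the root value, whence the ratios of
  scales in the sum.\<close>

function root_poly :: "nat \<Rightarrow> nat \<Rightarrow> nat falg" where
  "root_poly i j = scal (root_scale j * r (pr j) (pr i)) * (root_monomial i j - 1)
    - (\<Sum>s\<in>{i<..<j}. scal (root_scale j / root_scale s * r (pr j) (pr s)) * root_poly i s)"
  by auto
termination
  by (relation "measure snd") auto

declare root_poly.simps [simp del]

lemma root_scale_nonzero: "root_scale j \<noteq> 0"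
  using p2_neq_1 p_plus_1 by (simp add: root_scale_def)

lemma eval_root_poly:
  assumes \<gamma>: "\<gamma> \<in> T_hat \<theta> N nn" and "1 \<le> i" "i < j" "j < pr i"
  shows "eval_at \<gamma> (root_poly i j) = root_scale j * root_value \<gamma> i j"
  using assms(3,4)
proof (induction j rule: less_induct)
  case (less j)
  have "(\<Sum>s\<in>{i<..<j}. root_scale j / root_scale s * r (pr j) (pr s) * eval_at \<gamma> (root_poly i s))
      = (\<Sum>s\<in>{i<..<j}. root_scale j * (r (pr j) (pr s) * root_value \<gamma> i s))"
    using less root_scale_nonzero by (intro sum.cong refl) auto
  moreover have "eval_at \<gamma> (root_poly i j) =
      root_scale j * r (pr j) (pr i) * (Tor \<gamma> (pr j) * Tor \<gamma> i - 1)
      - (\<Sum>s\<in>{i<..<j}. root_scale j / root_scale s * r (pr j) (pr s) * eval_at \<gamma> (root_poly i s))"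
    unfolding root_poly.simps[of i j] eval_at.subst_simps
      eval_root_monomial[OF \<gamma> assms(2) less.prems] ..
  ultimately show ?case
    unfolding root_value_rec[OF \<gamma> assms(2) less.prems] right_diff_distrib sum_distrib_left mult.assoc
    by simp
qed

lemma root_monomial_in:
  assumes "1 \<le> i" "i < j" "j < pr i"
  shows "root_monomial i j \<in> falg_on {1..\<theta>}"
proof -
  have "1 \<le> pr j" "\<not> j \<le> \<theta> + 1 \<Longrightarrow> pr j \<le> \<theta>" using assms by (auto simp: prm_def)
  then show ?thesis
    unfolding root_monomial_def using assms(1)
    by (auto simp del: upt_Suc intro!: falg_on_mult falg_on_prod_list falg_on_power falg_on_gen)
qed

lemma root_poly_in:
  assumes "1 \<le> i" "i < j" "j < pr i"
  shows "root_poly i j \<in> falg_on {1..\<theta>}"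
  using assms(2,3)
proof (induction j rule: less_induct)
  case (less j)
  show ?case
    by (subst root_poly.simps, intro falg_on_diff falg_on_mult falg_on_scal falg_on_1 falg_on_sum
        root_monomial_in less.IH) (use less.prems assms(1) in auto)
qed

text \<open>The relators of the pointed Hopf algebra run over all elements meeting the specification
  \<open>is_r\<close>, so exhibiting this one makes the recursion available there.\<close>

lemma is_r_root_poly:
  assumes "1 \<le> i" "i < j" "j < pr i"
  shows "is_r \<theta> N nn q \<mu> i j (root_poly i j)"
  unfolding is_r_def
proof (intro conjI bexI[of _ "root_function i j"] ballI)
  show "root_poly i j \<in> falg_on {1..\<theta>}" using root_poly_in[OF assms] .
  show "hom_ext (frob_gen \<theta> N q) (root_function i j) - psi (rootE \<theta> q i j ^ N) \<in> OqB_ideal \<theta> q"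
    using frob_root_function[OF assms] .
  show "root_function i j \<in> falg_on (Bplus_coords \<theta>)"
    unfolding root_function_def using assms
    by (intro falg_on_intros) (auto simp: Bplus_coords_def prm_def nB_def)
  fix \<gamma> assume "\<gamma> \<in> T_hat \<theta> N nn"
  then show "eval_at \<gamma> (root_poly i j) = eval_at (entry (iota_mu \<theta> N q \<mu> \<gamma>)) (root_function i j)"
    using assms by (simp add: eval_root_poly root_function_def root_value_def eval_at.subst_simps)
qed

section \<open>Power root vector relations in the pointed Hopf algebra\<close>

abbreviation U_cong :: "ugen falg \<Rightarrow> ugen falg \<Rightarrow> bool" (infix "\<simeq>" 50) where
  "U_cong \<equiv> alg_cong (u_gens \<theta>) (u_rels \<theta> N nn q \<mu>)"

abbreviation x :: "nat \<Rightarrow> nat \<Rightarrow> ugen falg" where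
  "x \<equiv> x_root \<theta> nn q"

lemma x_in:
  assumes "1 \<le> i" "i \<le> \<theta>" "j < pr i"
  shows "x i j \<in> falg_on (u_gens \<theta>)"
  using assms(3)
proof (induction j)
  case 0
  then show ?case
    using assms by (simp add: x_root_def hom_ext.subst_simps u_gens_def falg_on_gen)
next
  case (Suc j)
  have g: "gen (x_gen k) \<in> falg_on (u_gens \<theta>)" if "k \<in> {1..\<theta>}" for k
    using that by (auto simp: u_gens_def intro!: falg_on_gen)
  have IH: "x i j \<in> falg_on (u_gens \<theta>)" using Suc by simp
  consider "j \<le> i" | "i < j" "Suc j \<le> \<theta> + 1" | "i < j" "\<not> Suc j \<le> \<theta> + 1" by linarith
  then show ?case
  proof cases
    case 1
    then show ?thesis using g[of i] assms by (simp add: x_root_def hom_ext.subst_simps)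
  next
    case 2
    then have "j \<in> {1..\<theta>}" using assms by auto
    then show ?thesis using 2 IH g[of j]
      by (simp add: x_root_def hom_ext.subst_simps falg_on_intros)
  next
    case 3
    then have "pr (Suc j) \<in> {1..\<theta>}" using assms Suc.prems by (auto simp: prm_def)
    then show ?thesis using 3 IH g[of "pr (Suc j)"]
      by (simp add: x_root_def hom_ext.subst_simps falg_on_intros)
  qed
qed

lemma incl_T_in:
  assumes "a \<in> falg_on {1..\<theta>}"
  shows "incl_T N a \<in> falg_on (u_gens \<theta>)"
proof -
  have "gen (g_gen i) \<in> falg_on (u_gens \<theta>)"
    if "w \<in> Poly_Mapping.keys a" "i \<in> set (letters w)" for w i
    using that assms by (intro falg_on_gen) (auto simp: falg_on_def u_gens_def)
  then show ?thesis
    unfolding incl_T_def subst_def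
    by (intro falg_on_sum falg_on_mult falg_on_scal falg_on_prod_list)
      (auto intro!: falg_on_power)
qed

lemma x_power_incl_T:
  assumes "1 \<le> i" "i < j" "j < pr i"
  shows "x i j ^ N \<simeq> incl_T N (root_poly i j)"
proof (rule alg_congI)
  have i: "i \<le> \<theta>" using assms by (auto simp: prm_def)
  have "x i j ^ N - incl_T N (root_poly i j) \<in> u_rels \<theta> N nn q \<mu>"
    unfolding u_rels_def
  proof (intro UnI2 CollectI exI conjI)
    show "(i, j) \<in> pos_roots \<theta>" using assms i by (auto simp: pos_roots_def)
  qed (rule refl is_r_root_poly[OF assms])+
  then show "x i j ^ N - incl_T N (root_poly i j) \<in> alg_ideal (u_gens \<theta>) (u_rels \<theta> N nn q \<mu>)"
    by (rule alg_ideal_relator)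
  show "x i j ^ N \<in> falg_on (u_gens \<theta>)" using x_in assms i by (intro falg_on_power) auto
  show "incl_T N (root_poly i j) \<in> falg_on (u_gens \<theta>)" using root_poly_in[OF assms] by (rule incl_T_in)
qed

lemma g_commute:
  assumes "i \<in> {1..\<theta>}" "j \<in> {1..\<theta>}"
  shows "gen (g_gen i) * gen (g_gen j) \<simeq> gen (g_gen j) * gen (g_gen i)"
proof (rule alg_congI)
  show "gen (g_gen i) * gen (g_gen j) - gen (g_gen j) * gen (g_gen i) \<in> alg_ideal (u_gens \<theta>) (u_rels \<theta> N nn q \<mu>)"
    unfolding u_rels_def
    by (rule alg_ideal_relator, intro UnI1, rule CollectI, use assms in blast)
qed (use assms in \<open>auto simp: u_gens_def intro!: falg_on_mult falg_on_gen\<close>)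

definition g_root :: "nat \<Rightarrow> nat \<Rightarrow> ugen falg" where
  "g_root i j = (if j \<le> \<theta> + 1 then g_lo i j else g_hi \<theta> i (pr j))"

lemma g_root_power:
  assumes "1 \<le> i" "i < j" "j < pr i"
  shows "g_root i j ^ N \<simeq> incl_T N (root_monomial i j)"
proof -
  \<comment> \<open>Squares are written as repeated letters, so that short and long roots are both a
    single product of commuting generators.\<close>
  define ks where "ks = (if j \<le> \<theta> + 1 then [i..<j]
    else [i..<pr j] @ concat (map (\<lambda>k. [k, k]) [pr j..<\<theta> + 1]))"
  have dbl: "prod_list (map f (concat (map (\<lambda>k. [k, k]) ks'))) = prod_list (map (\<lambda>k. f k ^ 2) ks')"
    for f :: "nat \<Rightarrow> 'a::monoid_mult" and ks'
    by (induction ks') (simp_all add: power2_eq_square mult.assoc)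
  let ?gs = "map (\<lambda>k. gen (g_gen k)) ks"
  have "1 \<le> pr j" "\<not> j \<le> \<theta> + 1 \<Longrightarrow> pr j \<le> \<theta>" using assms by (auto simp: prm_def)
  then have ks: "set ks \<subseteq> {1..\<theta>}"
    using assms(1) by (auto simp: ks_def simp del: upt_Suc)
  have "prod_list ?gs ^ N \<simeq> prod_list (map (\<lambda>a. a ^ N) ?gs)"
  proof (rule alg_cong_prod_list_power)
    show "set ?gs \<subseteq> falg_on (u_gens \<theta>)" using ks by (auto simp: u_gens_def intro!: falg_on_gen)
    show "a * b \<simeq> b * a" if "a \<in> set ?gs" "b \<in> set ?gs" for a b
      using that ks by (auto intro!: g_commute)
  qed
  moreover have "prod_list ?gs = g_root i j"
    by (simp add: g_root_def ks_def g_lo_def g_hi_def dbl del: upt_Suc)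
  moreover have "prod_list (map (\<lambda>a. a ^ N) ?gs) = incl_T N (root_monomial i j)"
    by (simp add: root_monomial_def ks_def incl_T_def hom_ext.subst_simps o_def dbl del: upt_Suc)
  ultimately show ?thesis by simp
qed

text \<open>The recursion of \<open>root_poly\<close> is transported by \<open>incl_T\<close>, and
  each \<open>root_poly i s\<close> is replaced by the power of the root vector it equals. Short and
  long roots differ only in the scalars.\<close>

lemma x_power_rec:
  assumes "1 \<le> i" "i < j" "j < pr i"
  shows "x i j ^ N \<simeq> scal (root_scale j * r (pr j) (pr i)) * (g_root i j ^ N - 1)
    - (\<Sum>s\<in>{i<..<j}. scal (root_scale j / root_scale s * r (pr j) (pr s)) * x i s ^ N)"
proof -
  have "x i j ^ N \<simeq> incl_T N (root_poly i j)" using x_power_incl_T[OF assms] .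
  also have "incl_T N (root_poly i j) =
      scal (root_scale j * r (pr j) (pr i)) * (incl_T N (root_monomial i j) - 1)
    - (\<Sum>s\<in>{i<..<j}. scal (root_scale j / root_scale s * r (pr j) (pr s)) * incl_T N (root_poly i s))"
    by (subst root_poly.simps) (simp add: incl_T_def hom_ext.subst_simps)
  also have "\<dots> \<simeq> scal (root_scale j * r (pr j) (pr i)) * (g_root i j ^ N - 1)
    - (\<Sum>s\<in>{i<..<j}. scal (root_scale j / root_scale s * r (pr j) (pr s)) * x i s ^ N)"
    using assms
    by (intro alg_cong_diff alg_cong_sum alg_cong_lmult alg_cong_sym[OF g_root_power]
        alg_cong_sym[OF x_power_incl_T] alg_cong_refl falg_on_1 falg_on_scal) auto
  finally show ?thesis .
qed

text \<open>All scales involved equal \<open>1 / (p\<^sup>2 - 1) ^ N\<close>; their ratios are 1,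
  and the factor in \<open>r_short\<close> cancels.\<close>

lemma x_power_short:
  assumes "1 \<le> i" "i < j" "j \<le> \<theta> + 1"
  shows "x i j ^ N \<simeq> scal (\<mu> i j) * (g_lo i j ^ N - 1)
    - (\<Sum>s\<in>{i+1..<j}. scal (r (pr j) (pr s)) * x i s ^ N)"
proof -
  have "(\<Sum>s\<in>{i<..<j}. scal (root_scale j / root_scale s * r (pr j) (pr s)) * x i s ^ N)
      = (\<Sum>s\<in>{i+1..<j}. scal (r (pr j) (pr s)) * x i s ^ N)"
    using assms p2_neq_1 by (intro sum.cong) (auto simp: root_scale_def)
  moreover have "root_scale j * r (pr j) (pr i) = \<mu> i j"
    using assms p2_neq_1 by (simp add: r_short root_scale_def)
  moreover have "j < pr i" using assms by (auto simp: prm_def)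
  ultimately show ?thesis
    using x_power_rec[of i j] assms by (simp add: g_root_def)
qed

text \<open>The sum over \<open>i < s < pr j\<close> is cut at \<theta>+1, its own mirror image. Up
  to there the ratio of scales is \<open>c\<close>; beyond, both roots are long and only the sign
  \<open>(-1) ^ (s - j)\<close> remains.\<close>

lemma x_power_long:
  assumes "1 \<le> i" "i < j" "j \<le> \<theta>"
  defines "c \<equiv> 2 * (-1) ^ (\<theta> + 1 - j) / (1 + p) ^ N"
  shows "x i (pr j) ^ N \<simeq> scal (\<mu> i (pr j)) * (g_hi \<theta> i j ^ N - 1)
    - scal c * (\<Sum>s\<in>{i+1..\<theta>}. scal (r j (pr s)) * x i s ^ N)
    - scal (c * r j (\<theta> + 1)) * x i (\<theta> + 1) ^ N
    - (\<Sum>s\<in>{\<theta>+2..<pr j}. scal ((-1) ^ (s - j) * r j (pr s)) * x i s ^ N)"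
proof -
  let ?J = "pr j"
  let ?t = "\<lambda>s. scal (root_scale ?J / root_scale s * r j (pr s)) * x i s ^ N"
  have J: "pr ?J = j" "i < ?J" "?J < pr i" "\<not> ?J \<le> \<theta> + 1" "\<theta> + 2 \<le> ?J"
    using assms by (auto simp: prm_def)
  have scale: "root_scale ?J = c / (p\<^sup>2 - 1) ^ N"
    using J by (simp add: root_scale_def c_def)
  have low: "?t s = scal c * (scal (r j (pr s)) * x i s ^ N)" if "s \<le> \<theta> + 1" for s
  proof -
    have "root_scale s = 1 / (p\<^sup>2 - 1) ^ N" using that by (simp add: root_scale_def)
    then have "root_scale ?J / root_scale s = c" unfolding scale using p2_neq_1 by simp
    then show ?thesis by (simp only: scal_mult mult.assoc)
  qed
  have high: "?t s = scal ((-1) ^ (s - j) * r j (pr s)) * x i s ^ N" if "s \<in> {\<theta>+2..<?J}" for s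
  proof -
    \<comment> \<open>The two exponents of -1 being compared differ by an even number.\<close>
    have s: "\<not> s \<le> \<theta> + 1" "pr s \<le> \<theta>" "s - j + (\<theta> + 1 - pr s) = \<theta> + 1 - j + 2 * (s - (\<theta> + 1))"
      using that assms by (auto simp: prm_def)
    have "(-1) ^ (s - j) * (-1) ^ (\<theta> + 1 - pr s) = (-1 :: complex) ^ (\<theta> + 1 - j)"
      unfolding power_add[symmetric] s(3) by (simp add: power_add)
    moreover have "root_scale s = 2 * (-1) ^ (\<theta> + 1 - pr s) / ((1 + p) ^ N * (p\<^sup>2 - 1) ^ N)"
      using s(1) by (simp add: root_scale_def)
    ultimately have "root_scale ?J = (-1) ^ (s - j) * root_scale s"
      unfolding scale c_def by (simp add: mult.left_commute)
    then show ?thesis using root_scale_nonzero[of s] by simp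
  qed
  have "{i<..<?J} = {i+1..\<theta>} \<union> ({\<theta>+1} \<union> {\<theta>+2..<?J})" using assms J by auto
  then have "(\<Sum>s\<in>{i<..<?J}. ?t s) = (\<Sum>s\<in>{i+1..\<theta>}. ?t s) + (?t (\<theta> + 1) + (\<Sum>s\<in>{\<theta>+2..<?J}. ?t s))"
    by (simp, subst sum.union_disjoint) auto
  also have "(\<Sum>s\<in>{i+1..\<theta>}. ?t s) = scal c * (\<Sum>s\<in>{i+1..\<theta>}. scal (r j (pr s)) * x i s ^ N)"
    unfolding sum_distrib_left by (intro sum.cong refl low) auto
  also have "?t (\<theta> + 1) = scal (c * r j (\<theta> + 1)) * x i (\<theta> + 1) ^ N"
    by (subst low) (simp_all add: scal_mult mult.assoc prm_def)
  also have "(\<Sum>s\<in>{\<theta>+2..<?J}. ?t s) = (\<Sum>s\<in>{\<theta>+2..<pr j}. scal ((-1) ^ (s - j) * r j (pr s)) * x i s ^ N)"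
    by (intro sum.cong refl high)
  finally have sum: "(\<Sum>s\<in>{i<..<?J}. ?t s) =
      scal c * (\<Sum>s\<in>{i+1..\<theta>}. scal (r j (pr s)) * x i s ^ N)
      + (scal (c * r j (\<theta> + 1)) * x i (\<theta> + 1) ^ N
      + (\<Sum>s\<in>{\<theta>+2..<pr j}. scal ((-1) ^ (s - j) * r j (pr s)) * x i s ^ N))" .
  \<comment> \<open>The sign in \<open>r_long\<close> cancels the one in the scale, as
    \<open>(p + 1) ^ N / 2\<close> cancels \<open>2 / (1 + p) ^ N\<close>.\<close>
  have "(-1 :: complex) ^ m * (-1) ^ m = 1" for m by (simp flip: power_mult_distrib)
  then have "root_scale ?J * r j (pr i) = \<mu> i (pr j)"
    using assms(1-3) p2_neq_1 p_plus_1
    by (simp add: r_long scale c_def add.commute[of p 1])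
  then show ?thesis
    using x_power_rec[of i ?J] assms J sum by (simp add: g_root_def diff_diff_eq add.assoc)
qed

end

theorem theorem4p6:
  fixes \<theta> N :: nat and nn :: "nat \<Rightarrow> nat" and q :: complex
    and \<mu> :: "nat \<Rightarrow> nat \<Rightarrow> complex"
  assumes "\<theta> \<ge> 2"
    and "odd N" and "N > 7" and "gcd 3 N = 1"
    and "q ^ N = 1" and "\<forall>m. 0 < m \<and> m < N \<longrightarrow> q ^ m \<noteq> 1"
    and "\<forall>i\<in>{1..\<theta>}. nn i > 0 \<and> N dvd nn i"
    and "root_vector_params \<theta> N nn q \<mu>"
  shows "\<forall>i j. 1 \<le> i \<and> i < j \<and> j \<le> \<theta> + 1 \<longrightarrow>
    u_eq \<theta> N nn q \<mu> (x_root \<theta> nn q i j ^ N)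
      (scal (\<mu> i j) * (g_lo i j ^ N - 1)
       - (\<Sum>s\<in>{i+1..<j}.
            scal (r_entry \<theta> N q \<mu> (prm \<theta> j) (prm \<theta> s)) * x_root \<theta> nn q i s ^ N))
    \<and> (j \<noteq> \<theta> + 1 \<longrightarrow>
    u_eq \<theta> N nn q \<mu> (x_root \<theta> nn q i (prm \<theta> j) ^ N)
      (scal (\<mu> i (prm \<theta> j)) * (g_hi \<theta> i j ^ N - 1)
       - scal (2 * (-1) ^ (\<theta> + 1 - j) / (1 + q1 q) ^ N) *
           (\<Sum>s\<in>{i+1..\<theta>}.
              scal (r_entry \<theta> N q \<mu> j (prm \<theta> s)) * x_root \<theta> nn q i s ^ N)
       - scal (2 * (-1) ^ (\<theta> + 1 - j) / (1 + q1 q) ^ N * r_entry \<theta> N q \<mu> j (\<theta> + 1)) *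
           x_root \<theta> nn q i (\<theta> + 1) ^ N
       - (\<Sum>s\<in>{\<theta>+2..<prm \<theta> j}.
            scal ((-1) ^ (s - j) * r_entry \<theta> N q \<mu> j (prm \<theta> s)) * x_root \<theta> nn q i s ^ N)))"
proof -
  interpret typeB_lifting \<theta> N q nn \<mu>
    by standard (use assms in auto)
  show ?thesis
    using x_power_short x_power_long by (simp add: u_eq_def alg_cong_def)
qed

end
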